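(* Let $A$ be a von Neumann hyperring. The following are equivalent: (i) $A$ is a mono-hyperring, i.e. the structural presheaf $\mathcal F_A$ is a monopresheaf. (ii) If $u\in A$ satisfies $u=1$ in $K_A(p)$ for every $p\in\mathrm{spec}(A)$, then $u=1$ in $A$. (iii) For every idempotent $e\in A$, $e+e^c=\{1\}$. If any of these conditions holds, then $A$ is geometric, and for all $a,b,c\in A$: $a\in b+c$ in $A$ if and only if $a\in b+c$ in $K_A(p)$ for every $p\in\mathrm{spec}(A)$. In particular, $a=b$ if and only if $a=b$ in $K_A(p)$ for all $p\in\mathrm{spec}(A)$.
   Context: A multiring is a tuple $(A,+,-,\cdot,0,1)$ where $(A,\cdot,1)$ is a commutative monoid, $+\colon A\times A\to\{\text{nonempty subsets of }A\}$ and $-\colon A\to A$ are functions and $0\in A$, such that for all $a,b,c,d\in A$: (1) $a\in b+c$ implies $c\in -b+a$ and $b\in a+(-c)$; (2) $a\in b+0$ iff $a=b$; (3) if $x\in g+c$ with $g\in a+b$, then there is $h\in b+c$ with $x\in a+h$; (4) $a+b=b+a$; (5) $a\cdot 0=0$; (6) $a\in b+c$ implies $ad\in bd+cd$. Sums of subsets are unions of elementwise sums. A hyperring is a multiring such that $x\in bd+cd$ implies $x=ad$ for some $a\in b+c$. A morphism of multirings $f$ satisfies $f(a)\in f(b)+f(c)$ whenever $a\in b+c$, and preserves $\cdot,-,0,1$. An ideal is a nonempty $\alpha\subseteq A$ with $\alpha+\alpha\subseteq\alpha$, $A\alpha\subseteq\alpha$; it is prime if $1\notin\alpha$ and $ab\in\alpha$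 implies $a\in\alpha$ or $b\in\alpha$. $\mathrm{spec}(A)$ is the set of prime ideals with the topology with basis $D(a)=\{p: a\notin p\}$, $a\in A$. $(x)$ denotes the ideal generated by $x$. A von Neumann hyperring is a hyperring $A$ such that for all $a\in A$ there is $b\in A$ with $a=a^2b$ (equivalently, $\mathrm{spec}(A)$ is a Boolean space and $A$ has no nonzero nilpotents). In such $A$, for an idempotent $e$ there is a unique element $e^c\in 1-e$ (here $1-e:=1+(-e)$) with $ee^c=0$. For a multiplicative set $S$ ($1\in S$, $SS\subseteq S$), $S^{-1}A$ is the multiring of fractions $a/s$, with $a/s=b/t$ iff $atu=bsu$ for some $u\in S$, $a/s\in b/t+c/u$ iff $atuv\in bsuv+cstv$ for some $v\in S$, and $(a/s)(b/t)=ab/st$. For an ideal $I$, $A/I$ is the set of classes of $a\sim b\Leftrightarrow (a-b)\cap I\ne\emptyset$, with $\overline a\in\overline b+\overline c$ iff $a\in b+c+i$ for some $i\in I$, and induced product. For $p\in\mathrm{spec}(A)$, $K_A(p)=((A/p)\setminus\{0\})^{-1}(A/p)$; elements of $A$ are viewed in $K_A(p)$ via the canonical map. For $a\in A$ let $S_a=\{x\in A:\exists n\ge0,\ a^n\in(x)\}$ (with $0^0=1$). The structural presheaf $\mathcal F=\mathcal F_A$ is defined on basic opens by $\mathcal F(D(a))=S_a^{-1}A$; if $D(a)\subseteq D(b)$ then $S_b\subseteq S_a$ and the restriction $\mathcal F_{b,a}\colon S_b^{-1}A\to S_a^{-1}A$ is the canonical morphism. $\mathcal F$ is a monopresheaf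 if for every cover $D(e)=\bigcup_{i\in I}D(e_i)$ and $a,b,c\in\mathcal F(D(e))$ with $\mathcal F_{e,e_i}(a)\in\mathcal F_{e,e_i}(b)+\mathcal F_{e,e_i}(c)$ for all $i$, one has $a\in b+c$ in $\mathcal F(D(e))$. $\mathcal F$ is a sheaf if it is a monopresheaf and, for every cover $D(e)=\bigcup_{i\in I}D(e_i)$ and elements $x_i\in\mathcal F(D(e_i))$ with $\mathcal F_{e_i,e_ie_j}(x_i)=\mathcal F_{e_j,e_ie_j}(x_j)$ for all $i,j$, there is $x\in\mathcal F(D(e))$ with $\mathcal F_{e,e_i}(x)=x_i$ for all $i$. $A$ is geometric if $\mathcal F_A$ is a sheaf. *)

theory Defs
  imports "HOL-Algebra.Group"
begin

section \<open>Multirings and hyperrings\<close>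

record 'a multiring = "'a monoid" +
  mzero :: 'a ("\<zero>\<index>")
  madd :: "'a \<Rightarrow> 'a \<Rightarrow> 'a set" (infixl "\<boxplus>\<index>" 65)
  mneg :: "'a \<Rightarrow> 'a" ("\<boxminus>\<index> _" [81] 80)

definition set_madd :: "('a, 'm) multiring_scheme \<Rightarrow> 'a set \<Rightarrow> 'a set \<Rightarrow> 'a set" where
  "set_madd A X Y = (\<Union>x\<in>X. \<Union>y\<in>Y. x \<boxplus>\<^bsub>A\<^esub> y)"

locale multiring = comm_monoid A for A (structure) +
  assumes mzero_closed: "\<zero> \<in> carrier A"
    and mneg_closed: "a \<in> carrier A \<Longrightarrow> \<boxminus> a \<in> carrier A"
    and madd_closed: "\<lbrakk>a \<in> carrier A; b \<in> carrier A\<rbrakk> \<Longrightarrow> a \<boxplus> b \<subseteq> carrier A"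
    and madd_nonempty: "\<lbrakk>a \<in> carrier A; b \<in> carrier A\<rbrakk> \<Longrightarrow> a \<boxplus> b \<noteq> {}"
    and madd_reversible:
      "\<lbrakk>a \<in> carrier A; b \<in> carrier A; c \<in> carrier A; a \<in> b \<boxplus> c\<rbrakk>
        \<Longrightarrow> c \<in> (\<boxminus> b) \<boxplus> a \<and> b \<in> a \<boxplus> (\<boxminus> c)"
    and madd_zero: "\<lbrakk>a \<in> carrier A; b \<in> carrier A\<rbrakk> \<Longrightarrow> a \<in> b \<boxplus> \<zero> \<longleftrightarrow> a = b"
    and madd_assoc:
      "\<lbrakk>a \<in> carrier A; b \<in> carrier A; c \<in> carrier A; g \<in> a \<boxplus> b; x \<in> g \<boxplus> c\<rbrakk>
        \<Longrightarrow> \<exists>h \<in> b \<boxplus> c. x \<in> a \<boxplus> h"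
    and madd_comm: "\<lbrakk>a \<in> carrier A; b \<in> carrier A\<rbrakk> \<Longrightarrow> a \<boxplus> b = b \<boxplus> a"
    and mult_zero: "a \<in> carrier A \<Longrightarrow> a \<otimes> \<zero> = \<zero>"
    and madd_mult:
      "\<lbrakk>a \<in> carrier A; b \<in> carrier A; c \<in> carrier A; d \<in> carrier A; a \<in> b \<boxplus> c\<rbrakk>
        \<Longrightarrow> a \<otimes> d \<in> (b \<otimes> d) \<boxplus> (c \<otimes> d)"

locale hyperring = multiring +
  assumes madd_mult_lift:
      "\<lbrakk>b \<in> carrier A; c \<in> carrier A; d \<in> carrier A; x \<in> (b \<otimes> d) \<boxplus> (c \<otimes> d)\<rbrakk>
        \<Longrightarrow> \<exists>a \<in> b \<boxplus> c. x = a \<otimes> d"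

locale von_neumann_hyperring = hyperring +
  assumes von_neumann: "a \<in> carrier A \<Longrightarrow> \<exists>b \<in> carrier A. a = a \<otimes> a \<otimes> b"

definition is_idempotent :: "('a, 'm) multiring_scheme \<Rightarrow> 'a \<Rightarrow> bool" where
  "is_idempotent A e \<longleftrightarrow> e \<in> carrier A \<and> e \<otimes>\<^bsub>A\<^esub> e = e"

text \<open>Existence and uniqueness of this element hold for idempotents of a hyperring; elsewhere
  the value is irrelevant.\<close>

definition idem_compl :: "('a, 'm) multiring_scheme \<Rightarrow> 'a \<Rightarrow> 'a" where
  "idem_compl A e =
    (THE f. f \<in> \<one>\<^bsub>A\<^esub> \<boxplus>\<^bsub>A\<^esub> (\<boxminus>\<^bsub>A\<^esub> e) \<and> e \<otimes>\<^bsub>A\<^esub> f = \<zero>\<^bsub>A\<^esub>)"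


section \<open>Ideals and the spectrum\<close>

definition mideal :: "('a, 'm) multiring_scheme \<Rightarrow> 'a set \<Rightarrow> bool" where
  "mideal A I \<longleftrightarrow> I \<subseteq> carrier A \<and> I \<noteq> {} \<and> set_madd A I I \<subseteq> I \<and>
    (\<forall>a\<in>carrier A. \<forall>x\<in>I. a \<otimes>\<^bsub>A\<^esub> x \<in> I)"

definition mprime :: "('a, 'm) multiring_scheme \<Rightarrow> 'a set \<Rightarrow> bool" where
  "mprime A p \<longleftrightarrow> mideal A p \<and> \<one>\<^bsub>A\<^esub> \<notin> p \<and>
    (\<forall>a\<in>carrier A. \<forall>b\<in>carrier A. a \<otimes>\<^bsub>A\<^esub> b \<in> p \<longrightarrow> a \<in> p \<or> b \<in> p)"

definition mideal_gen :: "('a, 'm) multiring_scheme \<Rightarrow> 'a \<Rightarrow> 'a set" where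
  "mideal_gen A x = \<Inter>{I. mideal A I \<and> x \<in> I}"

definition spec :: "('a, 'm) multiring_scheme \<Rightarrow> 'a set set" where
  "spec A = {p. mprime A p}"

definition basic_open :: "('a, 'm) multiring_scheme \<Rightarrow> 'a \<Rightarrow> 'a set set" where
  "basic_open A a = {p \<in> spec A. a \<notin> p}"


section \<open>Fractions, quotients and residue hyperfields\<close>

definition frac_rel ::
    "('a, 'm) multiring_scheme \<Rightarrow> 'a set \<Rightarrow> (('a \<times> 'a) \<times> ('a \<times> 'a)) set" where
  "frac_rel A S = {((a, s), (b, t)). a \<in> carrier A \<and> s \<in> S \<and> b \<in> carrier A \<and> t \<in> S \<and>
    (\<exists>u\<in>S. a \<otimes>\<^bsub>A\<^esub> t \<otimes>\<^bsub>A\<^esub> u = b \<otimes>\<^bsub>A\<^esub> s \<otimes>\<^bsub>A\<^esub> u)}"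

definition frac :: "('a, 'm) multiring_scheme \<Rightarrow> 'a set \<Rightarrow> 'a \<Rightarrow> 'a \<Rightarrow> ('a \<times> 'a) set" where
  "frac A S a s = frac_rel A S `` {(a, s)}"

text \<open>For a multiplicative set S, the operations below do not depend on representatives:
  the unions in the product and in the negation range over equal classes, and the sum of two
  fractions may be computed from any choice of numerators and denominators.\<close>

definition fractions :: "('a, 'm) multiring_scheme \<Rightarrow> 'a set \<Rightarrow> ('a \<times> 'a) set multiring" where
  "fractions A S = \<lparr>
    carrier = (carrier A \<times> S) // frac_rel A S,
    monoid.mult = (\<lambda>X Y. \<Union>(a, s)\<in>X. \<Union>(b, t)\<in>Y. frac A S (a \<otimes>\<^bsub>A\<^esub> b) (s \<otimes>\<^bsub>A\<^esub> t)),
    one = frac A S \<one>\<^bsub>A\<^esub> \<one>\<^bsub>A\<^esub>,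
    mzero = frac A S \<zero>\<^bsub>A\<^esub> \<one>\<^bsub>A\<^esub>,
    madd = (\<lambda>Y Z. {frac A S a s | a s. a \<in> carrier A \<and> s \<in> S \<and>
      (\<exists>(b, t)\<in>Y. \<exists>(c, u)\<in>Z. \<exists>v\<in>S.
        a \<otimes>\<^bsub>A\<^esub> t \<otimes>\<^bsub>A\<^esub> u \<otimes>\<^bsub>A\<^esub> v
          \<in> (b \<otimes>\<^bsub>A\<^esub> s \<otimes>\<^bsub>A\<^esub> u \<otimes>\<^bsub>A\<^esub> v) \<boxplus>\<^bsub>A\<^esub> (c \<otimes>\<^bsub>A\<^esub> s \<otimes>\<^bsub>A\<^esub> t \<otimes>\<^bsub>A\<^esub> v))}),
    mneg = (\<lambda>X. \<Union>(a, s)\<in>X. frac A S (\<boxminus>\<^bsub>A\<^esub> a) s)\<rparr>"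

definition quot_rel :: "('a, 'm) multiring_scheme \<Rightarrow> 'a set \<Rightarrow> ('a \<times> 'a) set" where
  "quot_rel A I = {(a, b). a \<in> carrier A \<and> b \<in> carrier A \<and>
    (a \<boxplus>\<^bsub>A\<^esub> (\<boxminus>\<^bsub>A\<^esub> b)) \<inter> I \<noteq> {}}"

definition quot_class :: "('a, 'm) multiring_scheme \<Rightarrow> 'a set \<Rightarrow> 'a \<Rightarrow> 'a set" where
  "quot_class A I a = quot_rel A I `` {a}"

definition quotient_multiring :: "('a, 'm) multiring_scheme \<Rightarrow> 'a set \<Rightarrow> 'a set multiring" where
  "quotient_multiring A I = \<lparr>
    carrier = carrier A // quot_rel A I,
    monoid.mult = (\<lambda>X Y. \<Union>a\<in>X. \<Union>b\<in>Y. quot_class A I (a \<otimes>\<^bsub>A\<^esub> b)),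
    one = quot_class A I \<one>\<^bsub>A\<^esub>,
    mzero = quot_class A I \<zero>\<^bsub>A\<^esub>,
    madd = (\<lambda>Y Z. {quot_class A I a | a. a \<in> carrier A \<and>
      (\<exists>b\<in>Y. \<exists>c\<in>Z. \<exists>i\<in>I. a \<in> set_madd A (b \<boxplus>\<^bsub>A\<^esub> c) {i})}),
    mneg = (\<lambda>X. \<Union>a\<in>X. quot_class A I (\<boxminus>\<^bsub>A\<^esub> a))\<rparr>"

definition nonzero :: "('a, 'm) multiring_scheme \<Rightarrow> 'a set" where
  "nonzero A = carrier A - {\<zero>\<^bsub>A\<^esub>}"

definition residue :: "('a, 'm) multiring_scheme \<Rightarrow> 'a set \<Rightarrow> ('a set \<times> 'a set) set multiring" where
  "residue A p = fractions (quotient_multiring A p) (nonzero (quotient_multiring A p))"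

definition to_residue :: "('a, 'm) multiring_scheme \<Rightarrow> 'a set \<Rightarrow> 'a \<Rightarrow> ('a set \<times> 'a set) set" where
  "to_residue A p a =
    frac (quotient_multiring A p) (nonzero (quotient_multiring A p))
      (quot_class A p a) \<one>\<^bsub>quotient_multiring A p\<^esub>"


section \<open>The structural presheaf\<close>

definition denoms :: "('a, 'm) multiring_scheme \<Rightarrow> 'a \<Rightarrow> 'a set" where
  "denoms A a = {x \<in> carrier A. \<exists>n::nat. a [^]\<^bsub>A\<^esub> n \<in> mideal_gen A x}"

text \<open>Sections over a basic open set are indexed by the element defining that set; the set of
  denominators, hence the multiring of sections, depends only on the open set.\<close>

definition sections :: "('a, 'm) multiring_scheme \<Rightarrow> 'a \<Rightarrow> ('a \<times> 'a) set multiring" where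
  "sections A a = fractions A (denoms A a)"

text \<open>\<open>restr A b a\<close> is the canonical morphism from sections over \<open>D(b)\<close> to sections over
  \<open>D(a)\<close>, sending \<open>x/s\<close> to \<open>x/s\<close>; it is meaningful when \<open>D(a)\<close> is contained in \<open>D(b)\<close>.\<close>

definition restr ::
    "('a, 'm) multiring_scheme \<Rightarrow> 'a \<Rightarrow> 'a \<Rightarrow> ('a \<times> 'a) set \<Rightarrow> ('a \<times> 'a) set" where
  "restr A b a X = (\<Union>(x, s)\<in>X. frac A (denoms A a) x s)"

definition basic_cover ::
    "('a, 'm) multiring_scheme \<Rightarrow> 'a \<Rightarrow> 'i set \<Rightarrow> ('i \<Rightarrow> 'a) \<Rightarrow> bool" where
  "basic_cover A e I f \<longleftrightarrow> e \<in> carrier A \<and> f \<in> I \<rightarrow> carrier A \<and>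
    basic_open A e = (\<Union>i\<in>I. basic_open A (f i))"

text \<open>In the next two definitions the index sets are subsets of the type \<open>'a\<close>. This covers
  families over arbitrary index sets: such a family takes values in \<open>'a\<close>, and repeating a member
  of a cover adds nothing, since the compatibility condition (with \<open>f i = f j\<close>, where \<open>f i\<close> and
  \<open>f i \<otimes> f i\<close> define the same open set) forces equal sections over equal members.\<close>

definition monopresheaf :: "('a, 'm) multiring_scheme \<Rightarrow> bool" where
  "monopresheaf A \<longleftrightarrow> (\<forall>e (I :: 'a set) f. basic_cover A e I f \<longrightarrow>
    (\<forall>a\<in>carrier (sections A e). \<forall>b\<in>carrier (sections A e). \<forall>c\<in>carrier (sections A e).
      (\<forall>i\<in>I. restr A e (f i) a \<in> restr A e (f i) b \<boxplus>\<^bsub>sections A (f i)\<^esub> restr A e (f i) c)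
        \<longrightarrow> a \<in> b \<boxplus>\<^bsub>sections A e\<^esub> c))"

definition gluing :: "('a, 'm) multiring_scheme \<Rightarrow> bool" where
  "gluing A \<longleftrightarrow> (\<forall>e (I :: 'a set) f x. basic_cover A e I f \<longrightarrow>
    (\<forall>i\<in>I. x i \<in> carrier (sections A (f i))) \<longrightarrow>
    (\<forall>i\<in>I. \<forall>j\<in>I. restr A (f i) (f i \<otimes>\<^bsub>A\<^esub> f j) (x i) = restr A (f j) (f i \<otimes>\<^bsub>A\<^esub> f j) (x j)) \<longrightarrow>
    (\<exists>y\<in>carrier (sections A e). \<forall>i\<in>I. restr A e (f i) y = x i))"

definition geometric :: "('a, 'm) multiring_scheme \<Rightarrow> bool" where
  "geometric A \<longleftrightarrow> monopresheaf A \<and> gluing A"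

end

theory Submission
  imports Defs
begin

text \<open>
  Everything in a von Neumann hyperring is controlled by idempotents. Each element \<open>a\<close> has a
  support: an idempotent that generates the same ideal as \<open>a\<close>. Inverting the denominators of
  \<open>D(a)\<close> therefore amounts to multiplying by the support \<open>s\<close> of \<open>a\<close>: every section over
  \<open>D(a)\<close> is some \<open>x/1\<close>, and a relation \<open>x/1 \<in> y/1 + z/1\<close> holds there iff \<open>xs \<in> ys + zs\<close> in \<open>A\<close>
  (\<open>section_carrierE\<close>, \<open>section_madd_iff\<close>). Likewise such a relation holds in the residue
  hyperfield at \<open>p\<close> iff it holds in \<open>A\<close> after multiplication by some idempotent outside \<open>p\<close>
  (\<open>to_residue_madd_iff\<close>): elements of \<open>p\<close> are killed by such idempotents, and elements outside
  \<open>p\<close> become invertible on their supports. Sections, stalks and elements of \<open>A\<close> are thus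
  compared inside \<open>A\<close>.

  For an idempotent \<open>e\<close> with complement \<open>f\<close>, every \<open>x\<close> lies in \<open>xe + xf\<close>, and any \<open>z\<close> in
  \<open>xe + yf\<close> agrees with \<open>x\<close> on \<open>e\<close> and with \<open>y\<close> on \<open>f\<close>. So pieces can always be put together; what
  may fail is that they determine the element. In particular an element \<open>u\<close> of \<open>e + f\<close> agrees with
  \<open>1\<close> on both pieces, hence in every residue hyperfield and on the two members of the cover
  \<open>D(1) = D(e) \<union> D(f)\<close>. Each of the first two conditions then forces \<open>u = 1\<close>, which is the third.

  Conversely, if \<open>e + f = {1}\<close> for all \<open>e\<close>, multiplication by \<open>x\<close> gives \<open>xe + xf = {x}\<close>, so that
  equalities and sums may be checked on the two pieces (\<open>eq_if_piecewise_eq\<close>,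
  \<open>madd_if_piecewise_madd\<close>). Compactness of the spectrum reduces arbitrary covers to such two-piece
  splittings. It enters as an induction principle (\<open>idem_local_induct\<close>): a property of idempotents
  that passes to smaller idempotents and can be recombined from two complementary pieces holds at
  \<open>e\<close> as soon as it holds near every prime of \<open>D(e)\<close>. Applied to "\<open>ag \<in> bg + cg\<close>" it gives the
  monopresheaf property and the detection of sums by residue hyperfields (\<open>madd_local\<close>); applied to
  "the given sections can be glued over \<open>D(g)\<close>" it gives the gluing property (\<open>glue_local\<close>).
\<close>

section \<open>Arithmetic in multirings\<close>

context multiring
begin

lemma madd_carrier:
  assumes "x \<in> a \<boxplus> b" "a \<in> carrier A" "b \<in> carrier A"
  shows "x \<in> carrier A"
  using assms madd_closed by blast

lemma zero_madd: "\<lbrakk>a \<in> carrier A; b \<in> carrier A\<rbrakk> \<Longrightarrow> a \<in> \<zero> \<boxplus> b \<longleftrightarrow> a = b"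
  using madd_zero madd_comm mzero_closed by metis

lemma zero_mult: "a \<in> carrier A \<Longrightarrow> \<zero> \<otimes> a = \<zero>"
  using mult_zero m_comm mzero_closed by metis

lemma zero_in_diff: "a \<in> carrier A \<Longrightarrow> \<zero> \<in> a \<boxplus> (\<boxminus> a)"
  using madd_reversible[of a a \<zero>] madd_zero[of a a] madd_comm[of "\<boxminus> a" a]
  by (simp add: mzero_closed mneg_closed)

lemma zero_in_diff_iff:
  assumes "a \<in> carrier A" "b \<in> carrier A"
  shows "\<zero> \<in> a \<boxplus> (\<boxminus> b) \<longleftrightarrow> a = b"
proof
  assume "\<zero> \<in> a \<boxplus> (\<boxminus> b)"
  then have *: "\<zero> \<in> (\<boxminus> b) \<boxplus> a"
    using assms madd_comm mneg_closed by blast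
  then have "a \<in> (\<boxminus> (\<boxminus> b)) \<boxplus> \<zero>"
    using assms madd_reversible mneg_closed mzero_closed by blast
  moreover have "b \<in> (\<boxminus> (\<boxminus> b)) \<boxplus> \<zero>"
    using zero_in_diff[OF assms(2)] madd_comm[of "\<boxminus> b" b]
      madd_reversible[of \<zero> "\<boxminus> b" b] assms mneg_closed mzero_closed by simp
  ultimately show "a = b"
    using madd_zero assms mneg_closed by metis
qed (use zero_in_diff assms in auto)

lemma neg_unique:
  assumes "a \<in> carrier A" "b \<in> carrier A" "\<zero> \<in> a \<boxplus> b"
  shows "b = \<boxminus> a"
  using assms madd_reversible[of \<zero> a b] madd_zero[of b "\<boxminus> a"] mneg_closed mzero_closed by blast

lemma neg_neg: "a \<in> carrier A \<Longrightarrow> \<boxminus> (\<boxminus> a) = a"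
  using neg_unique[of "\<boxminus> a" a] zero_in_diff[of a] madd_comm[of a "\<boxminus> a"] mneg_closed by auto

lemma neg_mult:
  assumes "a \<in> carrier A" "d \<in> carrier A"
  shows "(\<boxminus> a) \<otimes> d = \<boxminus> (a \<otimes> d)"
proof (rule neg_unique)
  show "\<zero> \<in> (a \<otimes> d) \<boxplus> ((\<boxminus> a) \<otimes> d)"
    using madd_mult[of \<zero> a "\<boxminus> a" d] zero_in_diff[of a] assms
    by (simp add: mneg_closed mzero_closed zero_mult)
qed (use assms mneg_closed in auto)

text \<open>The set-valued form of \<open>(a + b) + (c + d) = (a + c) + (b + d)\<close>; it allows sums to be
  regrouped by pieces.\<close>

lemma madd_interchange:
  assumes "a \<in> carrier A" "b \<in> carrier A" "c \<in> carrier A" "d \<in> carrier A"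
    and "x \<in> a \<boxplus> b" "y \<in> c \<boxplus> d" "z \<in> x \<boxplus> y"
  shows "\<exists>u \<in> a \<boxplus> c. \<exists>v \<in> b \<boxplus> d. z \<in> u \<boxplus> v"
proof -
  have x: "x \<in> carrier A" and y: "y \<in> carrier A"
    using assms madd_carrier by auto
  obtain h where h: "h \<in> b \<boxplus> y" "z \<in> a \<boxplus> h"
    using madd_assoc[of a b y x z] assms y by auto
  have hc: "h \<in> carrier A"
    using h assms y madd_carrier by auto
  obtain k where k: "k \<in> d \<boxplus> b" "h \<in> c \<boxplus> k"
    using madd_assoc[of c d b y h] assms h madd_comm[of b y] y by auto
  have kc: "k \<in> carrier A"
    using k assms madd_carrier by auto
  obtain l where l: "l \<in> c \<boxplus> a" "z \<in> k \<boxplus> l"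
    using madd_assoc[of k c a h z] madd_comm[of c k] madd_comm[of a h] assms h k kc hc by auto
  have lc: "l \<in> carrier A"
    using l assms madd_carrier by auto
  show ?thesis
    using k l madd_comm[of k l] madd_comm[of d b] madd_comm[of c a] kc lc assms by auto
qed

end

section \<open>Fractions\<close>

definition mult_set :: "('a, 'm) multiring_scheme \<Rightarrow> 'a set \<Rightarrow> bool" where
  "mult_set A S \<longleftrightarrow> S \<subseteq> carrier A \<and> \<one>\<^bsub>A\<^esub> \<in> S \<and> (\<forall>s\<in>S. \<forall>t\<in>S. s \<otimes>\<^bsub>A\<^esub> t \<in> S)"

context multiring
begin

lemma mult_setD:
  assumes "mult_set A S"
  shows "s \<in> S \<Longrightarrow> s \<in> carrier A" "\<one> \<in> S" "\<lbrakk>s \<in> S; t \<in> S\<rbrakk> \<Longrightarrow> s \<otimes> t \<in> S"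
  using assms by (auto simp: mult_set_def)

lemma frac_rel_trans:
  assumes S: "mult_set A S" and 1: "((a, s), (b, t)) \<in> frac_rel A S"
    and 2: "((b, t), (c, r)) \<in> frac_rel A S"
  shows "((a, s), (c, r)) \<in> frac_rel A S"
proof -
  note SD = mult_setD[OF S]
  have mem: "a \<in> carrier A" "b \<in> carrier A" "c \<in> carrier A" "s \<in> S" "t \<in> S" "r \<in> S"
    using 1 2 by (auto simp: frac_rel_def)
  obtain u v where uv: "u \<in> S" "v \<in> S" "a \<otimes> t \<otimes> u = b \<otimes> s \<otimes> u" "b \<otimes> r \<otimes> v = c \<otimes> t \<otimes> v"
    using 1 2 by (auto simp: frac_rel_def)
  have cl: "s \<in> carrier A" "t \<in> carrier A" "r \<in> carrier A" "u \<in> carrier A" "v \<in> carrier A"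
    using SD(1) mem uv by auto
  have "a \<otimes> r \<otimes> (t \<otimes> u \<otimes> v) = (a \<otimes> t \<otimes> u) \<otimes> (r \<otimes> v)"
    using cl mem by (simp add: m_ac)
  also have "\<dots> = (b \<otimes> r \<otimes> v) \<otimes> (s \<otimes> u)"
    using cl mem uv(3) by (simp add: m_ac)
  also have "\<dots> = c \<otimes> s \<otimes> (t \<otimes> u \<otimes> v)"
    using cl mem uv(4) by (simp add: m_ac)
  finally show ?thesis
    using mem uv SD(3) by (auto simp: frac_rel_def)
qed

lemma equiv_frac_rel:
  assumes S: "mult_set A S"
  shows "equiv (carrier A \<times> S) (frac_rel A S)"
proof (rule equivI)
  show "refl_on (carrier A \<times> S) (frac_rel A S)"
    using mult_setD(2)[OF S] by (auto simp: refl_on_def frac_rel_def)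
  show "sym (frac_rel A S)"
    by (auto simp: sym_def frac_rel_def) (metis)
  show "trans (frac_rel A S)"
    using frac_rel_trans[OF S] by (auto simp: trans_def)
qed (auto simp: frac_rel_def)

lemma frac_eq_iff:
  assumes "mult_set A S" "a \<in> carrier A" "b \<in> carrier A" "s \<in> S" "t \<in> S"
  shows "frac A S a s = frac A S b t \<longleftrightarrow> (\<exists>u\<in>S. a \<otimes> t \<otimes> u = b \<otimes> s \<otimes> u)"
  using eq_equiv_class_iff[OF equiv_frac_rel[OF assms(1)], of "(a, s)" "(b, t)"] assms(2-)
  by (auto simp: frac_def frac_rel_def)

lemma mem_frac_iff:
  assumes "mult_set A S" "a \<in> carrier A" "s \<in> S"
  shows "(b, t) \<in> frac A S a s \<longleftrightarrow> b \<in> carrier A \<and> t \<in> S \<and> frac A S b t = frac A S a s"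
proof -
  have "(b, t) \<in> frac A S a s \<longleftrightarrow>
      b \<in> carrier A \<and> t \<in> S \<and> (\<exists>u\<in>S. a \<otimes> t \<otimes> u = b \<otimes> s \<otimes> u)"
    using assms(2,3) by (auto simp: frac_def frac_rel_def)
  then show ?thesis
    using frac_eq_iff[OF assms(1) assms(2) _ assms(3)] by (metis (no_types))
qed

lemma frac_carrier: "\<lbrakk>a \<in> carrier A; s \<in> S\<rbrakk> \<Longrightarrow> frac A S a s \<in> carrier (fractions A S)"
  by (auto simp: fractions_def frac_def quotient_def)

lemma fractions_carrierE:
  assumes "x \<in> carrier (fractions A S)"
  obtains a s where "a \<in> carrier A" "s \<in> S" "x = frac A S a s"
  using assms by (auto simp: fractions_def frac_def quotient_def)

text \<open>After clearing denominators, membership in a sum of fractions is membership in \<open>A\<close> up to a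
  single multiplier from \<open>S\<close>: the multipliers witnessing changes of representative are
  collected into one.\<close>

lemma frac_madd_iff:
  assumes S: "mult_set A S" and abc: "a \<in> carrier A" "b \<in> carrier A" "c \<in> carrier A"
  shows "frac A S a \<one> \<in> frac A S b \<one> \<boxplus>\<^bsub>fractions A S\<^esub> frac A S c \<one> \<longleftrightarrow>
    (\<exists>v\<in>S. a \<otimes> v \<in> (b \<otimes> v) \<boxplus> (c \<otimes> v))" (is "?L \<longleftrightarrow> ?R")
proof
  note SD = mult_setD[OF S]
  assume ?L
  then obtain a' s b' t c' u v where
    a': "a' \<in> carrier A" "s \<in> S" "frac A S a' s = frac A S a \<one>" and
    b': "(b', t) \<in> frac A S b \<one>" and c': "(c', u) \<in> frac A S c \<one>" and v: "v \<in> S" and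
    sum: "a' \<otimes> t \<otimes> u \<otimes> v \<in> (b' \<otimes> s \<otimes> u \<otimes> v) \<boxplus> (c' \<otimes> s \<otimes> t \<otimes> v)"
    unfolding fractions_def by fastforce
  have b'': "b' \<in> carrier A" "t \<in> S" "frac A S b' t = frac A S b \<one>"
    using b' mem_frac_iff[OF S] abc SD by auto
  have c'': "c' \<in> carrier A" "u \<in> S" "frac A S c' u = frac A S c \<one>"
    using c' mem_frac_iff[OF S] abc SD by auto
  have cl: "s \<in> carrier A" "t \<in> carrier A" "u \<in> carrier A" "v \<in> carrier A"
    using a' b'' c'' v SD by auto
  obtain w1 where w1: "w1 \<in> S" "a' \<otimes> w1 = a \<otimes> s \<otimes> w1"
    using a' frac_eq_iff[OF S a'(1) abc(1) a'(2) SD(2)] by auto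
  obtain w2 where w2: "w2 \<in> S" "b' \<otimes> w2 = b \<otimes> t \<otimes> w2"
    using b'' frac_eq_iff[OF S b''(1) abc(2) b''(2) SD(2)] by auto
  obtain w3 where w3: "w3 \<in> S" "c' \<otimes> w3 = c \<otimes> u \<otimes> w3"
    using c'' frac_eq_iff[OF S c''(1) abc(3) c''(2) SD(2)] by auto
  have wcl: "w1 \<in> carrier A" "w2 \<in> carrier A" "w3 \<in> carrier A"
    using w1 w2 w3 SD by auto
  define w where "w = w1 \<otimes> w2 \<otimes> w3"
  define z where "z = s \<otimes> t \<otimes> u \<otimes> v \<otimes> w"
  have "a' \<otimes> t \<otimes> u \<otimes> v \<otimes> w = (a' \<otimes> w1) \<otimes> (t \<otimes> u \<otimes> v \<otimes> w2 \<otimes> w3)"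
    using a' cl wcl by (simp add: w_def m_ac)
  then have 1: "a' \<otimes> t \<otimes> u \<otimes> v \<otimes> w = a \<otimes> z"
    using w1 abc cl wcl by (simp add: w_def z_def m_ac)
  have "b' \<otimes> s \<otimes> u \<otimes> v \<otimes> w = (b' \<otimes> w2) \<otimes> (s \<otimes> u \<otimes> v \<otimes> w1 \<otimes> w3)"
    using b'' cl wcl by (simp add: w_def m_ac)
  then have 2: "b' \<otimes> s \<otimes> u \<otimes> v \<otimes> w = b \<otimes> z"
    using w2 abc cl wcl by (simp add: w_def z_def m_ac)
  have "c' \<otimes> s \<otimes> t \<otimes> v \<otimes> w = (c' \<otimes> w3) \<otimes> (s \<otimes> t \<otimes> v \<otimes> w1 \<otimes> w2)"
    using c'' cl wcl by (simp add: w_def m_ac)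
  then have 3: "c' \<otimes> s \<otimes> t \<otimes> v \<otimes> w = c \<otimes> z"
    using w3 abc cl wcl by (simp add: w_def z_def m_ac)
  have "a' \<otimes> t \<otimes> u \<otimes> v \<otimes> w \<in> (b' \<otimes> s \<otimes> u \<otimes> v \<otimes> w) \<boxplus> (c' \<otimes> s \<otimes> t \<otimes> v \<otimes> w)"
    using madd_mult[OF _ _ _ _ sum, of w] a' b'' c'' cl wcl by (simp add: w_def)
  then have "a \<otimes> z \<in> (b \<otimes> z) \<boxplus> (c \<otimes> z)"
    by (simp only: 1 2 3)
  moreover have "z \<in> S"
    using a' b'' c'' v w1 w2 w3 SD by (simp add: z_def w_def)
  ultimately show ?R by blast
next
  note SD = mult_setD[OF S]
  assume ?R
  then obtain v where v: "v \<in> S" "a \<otimes> v \<in> (b \<otimes> v) \<boxplus> (c \<otimes> v)" by blast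
  have "(b, \<one>) \<in> frac A S b \<one>" "(c, \<one>) \<in> frac A S c \<one>"
    using mem_frac_iff[OF S] abc SD by auto
  moreover have "a \<otimes> \<one> \<otimes> \<one> \<otimes> v \<in> (b \<otimes> \<one> \<otimes> \<one> \<otimes> v) \<boxplus> (c \<otimes> \<one> \<otimes> \<one> \<otimes> v)"
    using v abc by simp
  ultimately have "\<exists>(b', t)\<in>frac A S b \<one>. \<exists>(c', u)\<in>frac A S c \<one>. \<exists>v\<in>S.
      a \<otimes> t \<otimes> u \<otimes> v \<in> (b' \<otimes> \<one> \<otimes> u \<otimes> v) \<boxplus> (c' \<otimes> \<one> \<otimes> t \<otimes> v)"
    using v(1) by blast
  then have "\<exists>a' s. frac A S a \<one> = frac A S a' s \<and> a' \<in> carrier A \<and> s \<in> S \<and>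
      (\<exists>(b', t)\<in>frac A S b \<one>. \<exists>(c', u)\<in>frac A S c \<one>. \<exists>v\<in>S.
        a' \<otimes> t \<otimes> u \<otimes> v \<in> (b' \<otimes> s \<otimes> u \<otimes> v) \<boxplus> (c' \<otimes> s \<otimes> t \<otimes> v))"
    by (intro exI[of _ a] exI[of _ \<one>] conjI refl abc(1) SD(2))
  then show ?L
    by (simp only: fractions_def multiring.simps mem_Collect_eq)
qed

end

section \<open>Idempotents\<close>

context hyperring
begin

abbreviation idem :: "'a \<Rightarrow> bool" where "idem \<equiv> is_idempotent A"
abbreviation compl :: "'a \<Rightarrow> 'a" where "compl \<equiv> idem_compl A"

lemma idem_carrier: "idem e \<Longrightarrow> e \<in> carrier A"
  and idem_mult_self: "idem e \<Longrightarrow> e \<otimes> e = e"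
  by (auto simp: is_idempotent_def)

lemma idem_left: "\<lbrakk>idem e; x \<in> carrier A\<rbrakk> \<Longrightarrow> e \<otimes> (e \<otimes> x) = e \<otimes> x"
  by (metis idem_carrier idem_mult_self m_assoc)

lemma idem_one: "idem \<one>"
  by (simp add: is_idempotent_def)

lemma idem_zero: "idem \<zero>"
  by (simp add: is_idempotent_def mzero_closed mult_zero)

lemma idem_mult: "\<lbrakk>idem e; idem f\<rbrakk> \<Longrightarrow> idem (e \<otimes> f)"
  using idem_left[of e "f \<otimes> f"] m_lcomm[of f e f] m_assoc[of e f "e \<otimes> f"]
  by (simp add: is_idempotent_def)

text \<open>Since \<open>1 \<in> f + e\<close>, multiplying by \<open>g\<close> gives \<open>g \<in> fg + 0\<close>. By symmetry two complements
  are equal, and with \<open>f = g\<close> a complement is idempotent.\<close>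

lemma compl_unique:
  assumes e: "idem e" and f: "f \<in> \<one> \<boxplus> (\<boxminus> e)" "e \<otimes> f = \<zero>"
    and g: "g \<in> \<one> \<boxplus> (\<boxminus> e)" "e \<otimes> g = \<zero>"
  shows "g = g \<otimes> f"
proof -
  have cl: "e \<in> carrier A" "f \<in> carrier A" "g \<in> carrier A"
    using e f g madd_carrier idem_carrier mneg_closed by auto
  have "\<one> \<in> f \<boxplus> e"
    using madd_reversible[of f \<one> "\<boxminus> e"] f cl neg_neg mneg_closed by auto
  then have "\<one> \<otimes> g \<in> (f \<otimes> g) \<boxplus> (e \<otimes> g)"
    using madd_mult cl by blast
  then show ?thesis
    using madd_zero[of g "f \<otimes> g"] cl g by (simp add: m_comm)
qed

text \<open>A complement exists because \<open>0\<close> lies in \<open>e - e\<close>, which by the hyperring axiom is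
  \<open>(1 - e)e\<close>.\<close>

lemma compl_props:
  assumes e: "idem e"
  shows "compl e \<in> \<one> \<boxplus> (\<boxminus> e) \<and> e \<otimes> compl e = \<zero>"
proof -
  have cl: "e \<in> carrier A" using e idem_carrier by simp
  have "\<zero> \<in> (\<one> \<otimes> e) \<boxplus> ((\<boxminus> e) \<otimes> e)"
    using zero_in_diff[OF cl] neg_mult[OF cl cl] idem_mult_self[OF e] cl by simp
  then obtain f where f: "f \<in> \<one> \<boxplus> (\<boxminus> e)" "\<zero> = f \<otimes> e"
    using madd_mult_lift[of \<one> "\<boxminus> e" e \<zero>] cl mneg_closed by auto
  have fc: "f \<in> carrier A"
    using f cl mneg_closed madd_carrier by auto
  have f': "e \<otimes> f = \<zero>" using f fc cl m_comm by simp
  have "g = f" if "g \<in> \<one> \<boxplus> (\<boxminus> e) \<and> e \<otimes> g = \<zero>" for g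
  proof -
    have "g \<in> carrier A" using that cl mneg_closed madd_carrier by auto
    then show ?thesis
      using compl_unique[OF e f(1) f'] compl_unique[OF e _ _ f(1) f'] that m_comm[OF fc] by metis
  qed
  then show ?thesis
    unfolding idem_compl_def
    using theI[of "\<lambda>f. f \<in> \<one> \<boxplus> (\<boxminus> e) \<and> e \<otimes> f = \<zero>" f] f(1) f' by blast
qed

lemma compl_carrier: "idem e \<Longrightarrow> compl e \<in> carrier A"
  using compl_props madd_carrier[of "compl e" \<one> "\<boxminus> e"] idem_carrier mneg_closed by simp

lemma mult_compl: "idem e \<Longrightarrow> e \<otimes> compl e = \<zero>"
  using compl_props by auto

lemma one_in_idem_compl:
  assumes e: "idem e"
  shows "\<one> \<in> e \<boxplus> compl e"
proof -
  have cl: "e \<in> carrier A" "compl e \<in> carrier A" using e idem_carrier compl_carrier by auto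
  show ?thesis
    using madd_reversible[of "compl e" \<one> "\<boxminus> e"] compl_props[OF e] neg_neg[OF cl(1)] cl
      mneg_closed madd_comm by auto
qed

lemma idem_compl: "idem e \<Longrightarrow> idem (compl e)"
  using compl_unique[of e "compl e" "compl e"] compl_props compl_carrier
  by (auto simp: is_idempotent_def)

lemma decompose_along:
  assumes "idem e" "x \<in> carrier A"
  shows "x \<in> (x \<otimes> e) \<boxplus> (x \<otimes> compl e)"
  using madd_mult[OF _ _ _ assms(2) one_in_idem_compl[OF assms(1)]] assms idem_carrier compl_carrier
  by (simp add: m_comm)

lemma mult_compl_zero_iff:
  assumes e: "idem e" and x: "x \<in> carrier A"
  shows "x \<otimes> compl e = \<zero> \<longleftrightarrow> x \<otimes> e = x"
proof
  assume "x \<otimes> compl e = \<zero>"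
  then show "x \<otimes> e = x"
    using decompose_along[OF e x] madd_zero[of x "x \<otimes> e"] x idem_carrier[OF e] by simp
next
  assume "x \<otimes> e = x"
  then have "x \<otimes> compl e = x \<otimes> (e \<otimes> compl e)"
    using x e idem_carrier compl_carrier m_assoc by metis
  then show "x \<otimes> compl e = \<zero>"
    using x e by (simp add: mult_compl mult_zero)
qed

text \<open>Elements prescribed on two complementary idempotents: the component on the other piece is
  killed, and adding \<open>0\<close> is single-valued.\<close>

lemma piecewise_element:
  assumes e: "idem e" and xy: "x \<in> carrier A" "y \<in> carrier A"
    and z: "z \<in> (x \<otimes> e) \<boxplus> (y \<otimes> compl e)"
  shows "z \<otimes> e = x \<otimes> e" "z \<otimes> compl e = y \<otimes> compl e"
proof -
  have cl: "e \<in> carrier A" "compl e \<in> carrier A" using e idem_carrier compl_carrier by auto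
  have zc: "z \<in> carrier A" using z cl xy madd_carrier by auto
  have "z \<otimes> e \<in> (x \<otimes> e \<otimes> e) \<boxplus> (y \<otimes> compl e \<otimes> e)"
    using madd_mult[OF _ _ _ _ z, of e] zc cl xy by auto
  moreover have "x \<otimes> e \<otimes> e = x \<otimes> e" "y \<otimes> compl e \<otimes> e = \<zero>"
    using e cl xy by (simp_all add: m_assoc idem_mult_self m_comm[of "compl e"] mult_compl mult_zero)
  ultimately show "z \<otimes> e = x \<otimes> e"
    using madd_zero zc cl xy by simp
  have "z \<otimes> compl e \<in> (x \<otimes> e \<otimes> compl e) \<boxplus> (y \<otimes> compl e \<otimes> compl e)"
    using madd_mult[OF _ _ _ _ z, of "compl e"] zc cl xy by auto
  moreover have "y \<otimes> compl e \<otimes> compl e = y \<otimes> compl e" "x \<otimes> e \<otimes> compl e = \<zero>"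
    using e cl xy by (simp_all add: m_assoc idem_mult_self idem_compl mult_compl mult_zero)
  ultimately show "z \<otimes> compl e = y \<otimes> compl e"
    using zero_madd zc cl xy by simp
qed

end

section \<open>Ideals and primes\<close>

context hyperring
begin

lemma mideal_carrier: "\<lbrakk>mideal A I; x \<in> I\<rbrakk> \<Longrightarrow> x \<in> carrier A"
  and mideal_mult: "\<lbrakk>mideal A I; a \<in> carrier A; x \<in> I\<rbrakk> \<Longrightarrow> a \<otimes> x \<in> I"
  and mideal_madd: "\<lbrakk>mideal A I; x \<in> I; y \<in> I; z \<in> x \<boxplus> y\<rbrakk> \<Longrightarrow> z \<in> I"
  unfolding mideal_def set_madd_def by blast+

lemma mideal_mult_right: "\<lbrakk>mideal A I; a \<in> carrier A; x \<in> I\<rbrakk> \<Longrightarrow> x \<otimes> a \<in> I"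
  using mideal_mult mideal_carrier m_comm by metis

lemma mideal_zero: "mideal A I \<Longrightarrow> \<zero> \<in> I"
  using mideal_mult[of I \<zero>] mideal_carrier zero_mult mzero_closed unfolding mideal_def
  by (metis all_not_in_conv)

lemma mideal_principal:
  assumes "x \<in> carrier A"
  shows "mideal A {r \<otimes> x | r. r \<in> carrier A}"
proof -
  have "z \<in> {r \<otimes> x | r. r \<in> carrier A}"
    if "r \<in> carrier A" "s \<in> carrier A" "z \<in> (r \<otimes> x) \<boxplus> (s \<otimes> x)" for r s z
    using madd_mult_lift[OF that(1,2) assms that(3)] that madd_carrier by blast
  then show ?thesis
    unfolding mideal_def set_madd_def using assms
    by (auto intro: exI[of _ \<one>]) (metis m_assoc m_closed)
qed

lemma mideal_gen_eq:
  assumes "x \<in> carrier A"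
  shows "mideal_gen A x = {r \<otimes> x | r. r \<in> carrier A}"
proof
  have "x \<in> {r \<otimes> x | r. r \<in> carrier A}"
    using assms by (auto intro!: exI[of _ \<one>])
  then show "mideal_gen A x \<subseteq> {r \<otimes> x | r. r \<in> carrier A}"
    using mideal_principal[OF assms] unfolding mideal_gen_def by blast
  show "{r \<otimes> x | r. r \<in> carrier A} \<subseteq> mideal_gen A x"
    using mideal_mult unfolding mideal_gen_def by blast
qed

text \<open>\<open>M + Aa\<close> is closed under addition because \<open>ra + sa = (r + s)a\<close> in a hyperring; in a
  general multiring finite sums of multiples of \<open>a\<close> would be required.\<close>

lemma mideal_adjoin:
  assumes M: "mideal A M" and a: "a \<in> carrier A"
  defines "N \<equiv> {x. \<exists>m\<in>M. \<exists>r\<in>carrier A. x \<in> m \<boxplus> (r \<otimes> a)}"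
  shows "mideal A N" "M \<subseteq> N" "a \<in> N"
proof -
  show MN: "M \<subseteq> N"
  proof
    fix m assume m: "m \<in> M"
    have "m \<in> m \<boxplus> (\<zero> \<otimes> a)"
      using m a mideal_carrier[OF M] by (simp add: zero_mult madd_zero)
    then show "m \<in> N" using m mzero_closed unfolding N_def by blast
  qed
  have "a \<in> \<zero> \<boxplus> (\<one> \<otimes> a)"
    using a by (simp add: zero_madd)
  then show "a \<in> N" using mideal_zero[OF M] unfolding N_def by blast
  have add: "z \<in> N" if xyz: "x \<in> N" "y \<in> N" "z \<in> x \<boxplus> y" for x y z
  proof -
    obtain m r n s where
      m: "m \<in> M" "r \<in> carrier A" "x \<in> m \<boxplus> (r \<otimes> a)" and
      n: "n \<in> M" "s \<in> carrier A" "y \<in> n \<boxplus> (s \<otimes> a)"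
      using xyz unfolding N_def by blast
    obtain u v where uv: "u \<in> m \<boxplus> n" "v \<in> (r \<otimes> a) \<boxplus> (s \<otimes> a)" "z \<in> u \<boxplus> v"
      using madd_interchange[OF _ _ _ _ m(3) n(3) xyz(3)] m n a mideal_carrier[OF M] by auto
    obtain t where t: "t \<in> r \<boxplus> s" "v = t \<otimes> a"
      using madd_mult_lift[OF m(2) n(2) a uv(2)] by blast
    have "t \<in> carrier A" using t m n madd_carrier by blast
    then show ?thesis
      using mideal_madd[OF M m(1) n(1) uv(1)] uv t unfolding N_def by blast
  qed
  have mult: "b \<otimes> x \<in> N" if bx: "b \<in> carrier A" "x \<in> N" for b x
  proof -
    obtain m r where m: "m \<in> M" "r \<in> carrier A" "x \<in> m \<boxplus> (r \<otimes> a)"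
      using bx unfolding N_def by blast
    have mc: "m \<in> carrier A" using m mideal_carrier[OF M] by blast
    have xc: "x \<in> carrier A" using m mc a madd_carrier by blast
    have "x \<otimes> b \<in> (m \<otimes> b) \<boxplus> (r \<otimes> a \<otimes> b)"
      using madd_mult[OF _ _ _ _ m(3)] m mc xc a that by auto
    then have "b \<otimes> x \<in> (m \<otimes> b) \<boxplus> (r \<otimes> b \<otimes> a)"
      using m mc xc a that by (simp add: m_ac)
    then show ?thesis
      using mideal_mult_right[OF M that(1) m(1)] m that unfolding N_def by blast
  qed
  have "N \<subseteq> carrier A"
    using mideal_carrier[OF M] a madd_carrier unfolding N_def by blast
  then show "mideal A N"
    using add mult MN mideal_zero[OF M] unfolding mideal_def set_madd_def by blast
qed

text \<open>By Zorn's lemma there is an ideal \<open>M\<close> containing \<open>I\<close> that is maximal among those avoiding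
  \<open>e\<close>. If \<open>ab\<close> were in \<open>M\<close> but neither \<open>a\<close> nor \<open>b\<close>, then \<open>e\<close> would lie in both \<open>M + Aa\<close> and
  \<open>M + Ab\<close>, hence \<open>e = ee\<close> in \<open>M\<close>.\<close>

lemma exists_prime_avoiding:
  assumes I: "mideal A I" and e: "idem e" "e \<notin> I"
  shows "\<exists>p\<in>spec A. I \<subseteq> p \<and> e \<notin> p"
proof -
  have ec: "e \<in> carrier A" using e idem_carrier by simp
  define F where "F = {J. mideal A J \<and> I \<subseteq> J \<and> e \<notin> J}"
  have "\<exists>M\<in>F. \<forall>X\<in>F. M \<subseteq> X \<longrightarrow> X = M"
  proof (rule subset_Zorn_nonempty)
    show "F \<noteq> {}" using I e unfolding F_def by blast
    fix C assume C: "C \<noteq> {}" "subset.chain F C"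
    then have CF: "J \<in> C \<Longrightarrow> mideal A J \<and> I \<subseteq> J \<and> e \<notin> J" for J
      unfolding F_def subset_chain_def by blast
    have add: "z \<in> \<Union>C" if xyz: "x \<in> \<Union>C" "y \<in> \<Union>C" "z \<in> x \<boxplus> y" for x y z
    proof -
      obtain J K where JK: "J \<in> C" "x \<in> J" "K \<in> C" "y \<in> K" using xyz by blast
      then have "J \<subseteq> K \<or> K \<subseteq> J" using C unfolding subset_chain_def by blast
      then show ?thesis using JK xyz(3) mideal_madd CF by blast
    qed
    have "mideal A (\<Union>C)"
      unfolding mideal_def set_madd_def
    proof (intro conjI ballI)
      show "\<Union>C \<subseteq> carrier A" using CF mideal_carrier by blast
      show "\<Union>C \<noteq> {}" using C(1) CF mideal_zero by blast
      show "(\<Union>x\<in>\<Union>C. \<Union>y\<in>\<Union>C. x \<boxplus> y) \<subseteq> \<Union>C" using add by blast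
      show "a \<otimes> x \<in> \<Union>C" if "a \<in> carrier A" "x \<in> \<Union>C" for a x
        using that CF mideal_mult by blast
    qed
    then show "\<Union>C \<in> F" using C(1) CF unfolding F_def by blast
  qed
  then obtain M where MF: "M \<in> F" and maxF: "\<And>X. \<lbrakk>X \<in> F; M \<subseteq> X\<rbrakk> \<Longrightarrow> X = M"
    by blast
  have M: "mideal A M" "I \<subseteq> M" "e \<notin> M"
    using MF unfolding F_def by auto
  have max: "X = M" if "mideal A X" "M \<subseteq> X" "e \<notin> X" for X
    using maxF[of X] that M(2) unfolding F_def by auto
  have reach: "\<exists>m\<in>M. \<exists>r\<in>carrier A. e \<in> m \<boxplus> (r \<otimes> a)" if "a \<in> carrier A" "a \<notin> M" for a
    using mideal_adjoin[OF M(1) that(1)] max that(2) by blast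
  have "mprime A M"
    unfolding mprime_def
  proof (intro conjI ballI impI)
    show "mideal A M" by (rule M)
    show "\<one> \<notin> M" using mideal_mult[OF M(1) ec, of \<one>] M(3) ec by auto
    fix a b assume ab: "a \<in> carrier A" "b \<in> carrier A" "a \<otimes> b \<in> M"
    show "a \<in> M \<or> b \<in> M"
    proof (rule ccontr)
      assume "\<not> (a \<in> M \<or> b \<in> M)"
      then obtain m r n s where
        m: "m \<in> M" "r \<in> carrier A" "e \<in> m \<boxplus> (r \<otimes> a)" and
        n: "n \<in> M" "s \<in> carrier A" "e \<in> n \<boxplus> (s \<otimes> b)"
        using reach ab by meson
      have cl: "m \<in> carrier A" "n \<in> carrier A" using m n mideal_carrier[OF M(1)] by auto
      \<comment> \<open>Multiply \<open>e \<in> n + sb\<close> by \<open>ra\<close>: both summands lie in \<open>M\<close>.\<close>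
      have "e \<otimes> (r \<otimes> a) \<in> (n \<otimes> (r \<otimes> a)) \<boxplus> (s \<otimes> b \<otimes> (r \<otimes> a))"
        using madd_mult[OF _ _ _ _ n(3)] n m cl ab ec by auto
      moreover have "s \<otimes> b \<otimes> (r \<otimes> a) = (s \<otimes> r) \<otimes> (a \<otimes> b)"
        using n m ab by (simp add: m_ac)
      ultimately have ra: "r \<otimes> a \<otimes> e \<in> M"
        using mideal_madd[OF M(1) mideal_mult_right[OF M(1) _ n(1), of "r \<otimes> a"]
            mideal_mult[OF M(1) _ ab(3), of "s \<otimes> r"]] n m ab ec by (simp add: m_comm)
      have "e \<otimes> e \<in> (m \<otimes> e) \<boxplus> (r \<otimes> a \<otimes> e)"
        using madd_mult[OF _ _ _ _ m(3)] m cl ab ec by auto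
      then show False
        using mideal_madd[OF M(1) mideal_mult_right[OF M(1) ec m(1)] ra] M(3)
          idem_mult_self[OF e(1)] by auto
    qed
  qed
  then show ?thesis using M unfolding spec_def by blast
qed

lemma prime_mideal: "p \<in> spec A \<Longrightarrow> mideal A p"
  and one_notin_prime: "p \<in> spec A \<Longrightarrow> \<one> \<notin> p"
  unfolding spec_def mprime_def by auto

lemma prime_mult_iff:
  assumes "p \<in> spec A" "a \<in> carrier A" "b \<in> carrier A"
  shows "a \<otimes> b \<in> p \<longleftrightarrow> a \<in> p \<or> b \<in> p"
  using assms mideal_mult mideal_mult_right prime_mideal unfolding spec_def mprime_def by blast

lemma compl_mem_prime_iff:
  assumes p: "p \<in> spec A" and e: "idem e"
  shows "compl e \<in> p \<longleftrightarrow> e \<notin> p"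
proof -
  have "e \<in> p \<or> compl e \<in> p"
    using prime_mult_iff[OF p, of e "compl e"] mult_compl[OF e] mideal_zero[OF prime_mideal[OF p]]
      e idem_carrier compl_carrier by auto
  moreover have "\<not> (e \<in> p \<and> compl e \<in> p)"
    using mideal_madd[OF prime_mideal[OF p] _ _ one_in_idem_compl[OF e]] one_notin_prime[OF p] by blast
  ultimately show ?thesis by blast
qed

text \<open>Compactness of the spectrum as an induction principle. The elements lying below some
  idempotent with property \<open>P\<close> form an ideal \<open>J\<close>: recombination along complements makes \<open>P\<close>
  stable under joins of idempotents. If \<open>e\<close> were not in \<open>J\<close>, a prime containing \<open>J\<close> but not
  \<open>e\<close> would contain all idempotents with property \<open>P\<close>, contrary to the local
  assumption.\<close>

lemma idem_local_induct:
  assumes zero: "P \<zero>"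
    and restrict: "\<And>g h. \<lbrakk>idem g; idem h; P g\<rbrakk> \<Longrightarrow> P (g \<otimes> h)"
    and split: "\<And>g h. \<lbrakk>idem g; idem h; P (g \<otimes> h); P (g \<otimes> compl h)\<rbrakk> \<Longrightarrow> P g"
    and e: "idem e"
    and local: "\<And>p. \<lbrakk>p \<in> spec A; e \<notin> p\<rbrakk> \<Longrightarrow> \<exists>f. idem f \<and> f \<notin> p \<and> P f"
  shows "P e"
proof -
  define J where "J = {x \<in> carrier A. \<exists>g. idem g \<and> x \<otimes> g = x \<and> P g}"
  have join: "\<exists>d. idem d \<and> P d \<and> (\<forall>z x y. x \<in> carrier A \<longrightarrow> y \<in> carrier A \<longrightarrow>
      x \<otimes> g = x \<longrightarrow> y \<otimes> h = y \<longrightarrow> z \<in> x \<boxplus> y \<longrightarrow> z \<otimes> d = z)"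
    if g: "idem g" "P g" and h: "idem h" "P h" for g h
  proof -
    \<comment> \<open>The join of \<open>g\<close> and \<open>h\<close> in the Boolean algebra of idempotents.\<close>
    define k where "k = compl g \<otimes> compl h"
    define d where "d = compl k"
    have k: "idem k" and d: "idem d"
      using g h by (simp_all add: k_def d_def idem_mult idem_compl)
    have cl: "g \<in> carrier A" "h \<in> carrier A" "compl g \<in> carrier A" "compl h \<in> carrier A"
      "k \<in> carrier A" "d \<in> carrier A"
      using g h k d idem_carrier compl_carrier by auto
    have gk: "g \<otimes> k = \<zero>" "h \<otimes> k = \<zero>"
    proof -
      have "g \<otimes> k = (g \<otimes> compl g) \<otimes> compl h" using cl by (simp add: k_def m_ac)
      then show "g \<otimes> k = \<zero>" using g cl by (simp add: mult_compl zero_mult)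
      have "h \<otimes> k = (h \<otimes> compl h) \<otimes> compl g" using cl by (simp add: k_def m_ac)
      then show "h \<otimes> k = \<zero>" using h cl by (simp add: mult_compl zero_mult)
    qed
    have absorb: "x \<otimes> d = x" if "x \<in> carrier A" "x \<otimes> k = \<zero>" for x
      using decompose_along[OF k that(1)] that cl zero_madd by (simp add: d_def)
    have "P (d \<otimes> g)"
      using absorb[OF cl(1) gk(1)] cl g by (simp add: m_comm)
    moreover have "P (d \<otimes> compl g)"
    proof -
      have "d \<otimes> compl g \<otimes> compl h = k \<otimes> compl k"
        using cl by (simp add: d_def k_def m_ac)
      then have "d \<otimes> compl g \<otimes> h = d \<otimes> compl g"
        using mult_compl_zero_iff[OF h(1), of "d \<otimes> compl g"] mult_compl[OF k] cl by simp
      then have "d \<otimes> compl g = h \<otimes> (d \<otimes> compl g)" using cl m_comm by simp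
      then show ?thesis
        using restrict[OF h(1) _ h(2), of "d \<otimes> compl g"] d g by (simp add: idem_mult idem_compl)
    qed
    ultimately have "P d" using split d g by blast
    moreover have "z \<otimes> d = z" if xy: "x \<in> carrier A" "y \<in> carrier A"
      "x \<otimes> g = x" "y \<otimes> h = y" "z \<in> x \<boxplus> y" for x y z
    proof (rule absorb)
      show zc: "z \<in> carrier A" using xy madd_carrier by blast
      have "x \<otimes> k = x \<otimes> (g \<otimes> k)" "y \<otimes> k = y \<otimes> (h \<otimes> k)"
        using xy cl m_assoc by metis+
      then have "x \<otimes> k = \<zero>" "y \<otimes> k = \<zero>" using xy gk mult_zero by auto
      then have "z \<otimes> k \<in> \<zero> \<boxplus> \<zero>"
        using madd_mult[OF zc xy(1,2) cl(5) xy(5)] by simp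
      then show "z \<otimes> k = \<zero>" using madd_zero mzero_closed zc cl by simp
    qed
    ultimately show ?thesis using d by blast
  qed
  have "mideal A J"
    unfolding mideal_def set_madd_def
  proof (intro conjI ballI)
    show "J \<subseteq> carrier A" unfolding J_def by blast
    have "\<zero> \<in> J"
      unfolding J_def using zero idem_zero mzero_closed mult_zero by blast
    then show "J \<noteq> {}" by blast
    show "(\<Union>x\<in>J. \<Union>y\<in>J. x \<boxplus> y) \<subseteq> J"
    proof clarify
      fix x y z assume xy: "x \<in> J" "y \<in> J" "z \<in> x \<boxplus> y"
      then obtain g h where "idem g" "x \<otimes> g = x" "P g" "idem h" "y \<otimes> h = y" "P h"
        "x \<in> carrier A" "y \<in> carrier A"
        unfolding J_def by blast
      then show "z \<in> J"
        using join[of g h] xy(3) madd_carrier unfolding J_def by blast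
    qed
    show "a \<otimes> x \<in> J" if "a \<in> carrier A" "x \<in> J" for a x
      using that m_assoc idem_carrier unfolding J_def by auto
  qed
  have "e \<in> J"
  proof (rule ccontr)
    assume "e \<notin> J"
    then obtain p where p: "p \<in> spec A" "J \<subseteq> p" "e \<notin> p"
      using exists_prime_avoiding[OF \<open>mideal A J\<close> e] by blast
    then obtain f where f: "idem f" "f \<notin> p" "P f" using local by blast
    then have "f \<in> J"
      unfolding J_def using idem_carrier idem_mult_self by blast
    then show False using p f by blast
  qed
  then obtain g where "idem g" "e \<otimes> g = e" "P g" unfolding J_def by blast
  then show "P e"
    using restrict[of g e] e idem_carrier m_comm by metis
qed

end

section \<open>Supports\<close>

context von_neumann_hyperring
begin

text \<open>The idempotent generating the same ideal as \<open>a\<close>; if \<open>a = a\<^sup>2b\<close>, it is \<open>ab\<close>.\<close>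

definition supp :: "'a \<Rightarrow> 'a" where
  "supp a = (SOME e. idem e \<and> a \<otimes> e = a \<and> (\<exists>r\<in>carrier A. a \<otimes> r = e))"

lemma supp_props:
  assumes a: "a \<in> carrier A"
  shows "idem (supp a) \<and> a \<otimes> supp a = a \<and> (\<exists>r\<in>carrier A. a \<otimes> r = supp a)"
proof -
  obtain b where b: "b \<in> carrier A" "a = a \<otimes> a \<otimes> b"
    using von_neumann[OF a] by blast
  have "a \<otimes> b \<otimes> (a \<otimes> b) = (a \<otimes> a \<otimes> b) \<otimes> b" and ab: "a \<otimes> (a \<otimes> b) = a \<otimes> a \<otimes> b"
    using a b(1) by (simp_all add: m_ac)
  then have "idem (a \<otimes> b)"
    using a b by (simp add: is_idempotent_def)
  then have "\<exists>e. idem e \<and> a \<otimes> e = a \<and> (\<exists>r\<in>carrier A. a \<otimes> r = e)"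
    using a b ab by (intro exI[of _ "a \<otimes> b"]) auto
  then show ?thesis
    unfolding supp_def by (rule someI_ex)
qed

lemma supp_idem: "a \<in> carrier A \<Longrightarrow> idem (supp a)"
  and mult_supp: "a \<in> carrier A \<Longrightarrow> a \<otimes> supp a = a"
  and supp_carrier: "a \<in> carrier A \<Longrightarrow> supp a \<in> carrier A"
  using supp_props idem_carrier by auto

lemma supp_factor:
  assumes "a \<in> carrier A"
  obtains r where "r \<in> carrier A" "a \<otimes> r = supp a"
  using supp_props[OF assms] by blast

lemma supp_unique:
  assumes a: "a \<in> carrier A" and e: "idem e" "a \<otimes> e = a"
    and r: "r \<in> carrier A" "a \<otimes> r = e"
  shows "supp a = e"
proof -
  obtain s where s: "s \<in> carrier A" "a \<otimes> s = supp a" using supp_factor[OF a] .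
  have ec: "e \<in> carrier A" using e idem_carrier by simp
  have "supp a \<otimes> e = a \<otimes> e \<otimes> s"
    using a s(1) ec by (simp add: s(2)[symmetric] m_ac)
  then have "supp a \<otimes> e = supp a" using e s by simp
  moreover have "supp a \<otimes> e = a \<otimes> supp a \<otimes> r"
    using a r(1) supp_carrier[OF a] by (simp add: r(2)[symmetric] m_ac)
  then have "supp a \<otimes> e = e" using mult_supp[OF a] r by simp
  ultimately show ?thesis by simp
qed

lemma supp_of_idem: "idem e \<Longrightarrow> supp e = e"
  using supp_unique[of e e \<one>] by (simp add: idem_carrier idem_mult_self)

lemma supp_mult:
  assumes ab: "a \<in> carrier A" "b \<in> carrier A"
  shows "supp (a \<otimes> b) = supp a \<otimes> supp b"
proof -
  obtain r where r: "r \<in> carrier A" "a \<otimes> r = supp a" using supp_factor[OF ab(1)] .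
  obtain s where s: "s \<in> carrier A" "b \<otimes> s = supp b" using supp_factor[OF ab(2)] .
  have "a \<otimes> b \<otimes> (supp a \<otimes> supp b) = (a \<otimes> supp a) \<otimes> (b \<otimes> supp b)"
    and "a \<otimes> b \<otimes> (r \<otimes> s) = (a \<otimes> r) \<otimes> (b \<otimes> s)"
    using ab r(1) s(1) supp_carrier by (simp_all add: m_ac)
  then show ?thesis
    using supp_unique[of "a \<otimes> b" "supp a \<otimes> supp b" "r \<otimes> s"] ab r s
    by (simp add: idem_mult supp_idem mult_supp)
qed

lemma supp_mem_prime_iff:
  assumes p: "p \<in> spec A" and a: "a \<in> carrier A"
  shows "supp a \<in> p \<longleftrightarrow> a \<in> p"
proof -
  obtain r where r: "r \<in> carrier A" "a \<otimes> r = supp a" using supp_factor[OF a] .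
  show ?thesis
    using prime_mult_iff[OF p a r(1)] prime_mult_iff[OF p a supp_carrier[OF a]] r mult_supp[OF a]
      mideal_mult_right[OF prime_mideal[OF p] r(1)] by metis
qed

text \<open>The part of the support of \<open>a\<close> outside that of \<open>b\<close> lies in every prime, and a nonzero
  idempotent is avoided by some prime.\<close>

lemma supp_mult_if_basic_open_subset:
  assumes ab: "a \<in> carrier A" "b \<in> carrier A" and sub: "basic_open A a \<subseteq> basic_open A b"
  shows "supp a \<otimes> supp b = supp a"
proof -
  define g where "g = supp a \<otimes> compl (supp b)"
  have cl: "supp a \<in> carrier A" "compl (supp b) \<in> carrier A"
    using ab supp_idem idem_carrier compl_carrier by auto
  have g: "idem g" using ab by (simp add: g_def idem_mult idem_compl supp_idem)
  have zero: "mideal A {\<zero>}"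
    unfolding mideal_def set_madd_def using mzero_closed madd_zero[OF madd_carrier] mult_zero by auto
  have "g = \<zero>"
  proof (rule ccontr)
    assume "g \<noteq> \<zero>"
    then obtain p where p: "p \<in> spec A" "g \<notin> p"
      using exists_prime_avoiding[OF zero g] by auto
    then have "supp a \<notin> p" "compl (supp b) \<notin> p"
      using prime_mult_iff[OF p(1) cl] unfolding g_def by auto
    then have "p \<in> basic_open A a" "p \<notin> basic_open A b"
      using compl_mem_prime_iff[OF p(1) supp_idem[OF ab(2)]] supp_mem_prime_iff[OF p(1)] ab p
      unfolding basic_open_def by auto
    then show False using sub by blast
  qed
  then show ?thesis
    using mult_compl_zero_iff[OF supp_idem[OF ab(2)] cl(1)] unfolding g_def by simp
qed

end

section \<open>Sections over basic open sets\<close>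

context von_neumann_hyperring
begin

lemma pow_dvd_supp:
  assumes a: "a \<in> carrier A"
  shows "\<exists>t\<in>carrier A. a [^] (n::nat) \<otimes> t = supp a"
proof (induction n)
  case 0
  then show ?case using supp_carrier[OF a] by auto
next
  case (Suc n)
  then obtain t where t: "t \<in> carrier A" "a [^] n \<otimes> t = supp a" by blast
  obtain s where s: "s \<in> carrier A" "a \<otimes> s = supp a" using supp_factor[OF a] .
  have "a [^] Suc n \<otimes> (s \<otimes> t) = (a \<otimes> s) \<otimes> (a [^] n \<otimes> t)"
    using a s(1) t(1) by (simp add: m_ac)
  also have "\<dots> = supp a"
    using s t idem_mult_self[OF supp_idem[OF a]] by simp
  finally show ?case using s t by blast
qed

text \<open>Powers of \<open>a\<close> divide its support and the support divides \<open>a\<close>, so a denominator over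
  \<open>D(a)\<close> is exactly a divisor of the support of \<open>a\<close>.\<close>

lemma mem_denoms_iff:
  assumes a: "a \<in> carrier A"
  shows "x \<in> denoms A a \<longleftrightarrow> x \<in> carrier A \<and> (\<exists>r\<in>carrier A. x \<otimes> r = supp a)"
proof safe
  assume "x \<in> denoms A a"
  then obtain n :: nat where x: "x \<in> carrier A" "a [^] n \<in> mideal_gen A x"
    unfolding denoms_def by blast
  then obtain r where r: "r \<in> carrier A" "a [^] n = r \<otimes> x"
    using mideal_gen_eq by auto
  obtain t where t: "t \<in> carrier A" "a [^] n \<otimes> t = supp a" using pow_dvd_supp[OF a] by blast
  have "x \<otimes> (r \<otimes> t) = r \<otimes> x \<otimes> t" using x r(1) t(1) by (simp add: m_ac)
  then have "x \<otimes> (r \<otimes> t) = supp a" using r t by simp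
  then show "\<exists>r\<in>carrier A. x \<otimes> r = supp a" using r t by blast
  show "x \<in> carrier A" by (rule x)
next
  fix r assume x: "x \<in> carrier A" and r: "r \<in> carrier A" "x \<otimes> r = supp a"
  have "a [^] (1::nat) = (a \<otimes> r) \<otimes> x"
    using a x r(1) mult_supp[OF a] by (simp add: r(2)[symmetric] m_ac)
  then have "a [^] (1::nat) \<in> mideal_gen A x"
    unfolding mideal_gen_eq[OF x] using a r(1) by blast
  then show "x \<in> denoms A a" unfolding denoms_def using x by blast
qed

lemma mult_set_denoms:
  assumes a: "a \<in> carrier A"
  shows "mult_set A (denoms A a)"
  unfolding mult_set_def
proof (intro conjI ballI)
  show "denoms A a \<subseteq> carrier A" using mem_denoms_iff[OF a] by blast
  show "\<one> \<in> denoms A a"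
    unfolding mem_denoms_iff[OF a]
    by (intro conjI one_closed bexI[of _ "supp a"] l_one supp_carrier a)
  fix s t assume "s \<in> denoms A a" "t \<in> denoms A a"
  then obtain r q where rq: "s \<in> carrier A" "t \<in> carrier A" "r \<in> carrier A" "q \<in> carrier A"
    and eq: "s \<otimes> r = supp a" "t \<otimes> q = supp a"
    unfolding mem_denoms_iff[OF a] by (elim conjE bexE)
  have "s \<otimes> t \<otimes> (r \<otimes> q) = (s \<otimes> r) \<otimes> (t \<otimes> q)" using rq by (simp add: m_ac)
  then have "s \<otimes> t \<otimes> (r \<otimes> q) = supp a"
    using eq idem_mult_self[OF supp_idem[OF a]] by simp
  then show "s \<otimes> t \<in> denoms A a"
    unfolding mem_denoms_iff[OF a] using rq by (intro conjI bexI[of _ "r \<otimes> q"]) simp_all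
qed

lemma supp_in_denoms: "a \<in> carrier A \<Longrightarrow> supp a \<in> denoms A a"
  unfolding mem_denoms_iff by (intro conjI bexI[of _ \<one>]) (simp_all add: supp_carrier)

lemma denoms_mono:
  assumes ab: "a \<in> carrier A" "b \<in> carrier A" and sub: "supp a \<otimes> supp b = supp a"
  shows "denoms A b \<subseteq> denoms A a"
proof
  fix x assume "x \<in> denoms A b"
  then obtain r where x: "x \<in> carrier A" and r: "r \<in> carrier A" "x \<otimes> r = supp b"
    using mem_denoms_iff[OF ab(2)] by blast
  have "x \<otimes> (r \<otimes> supp a) = supp a"
    using x r ab sub supp_carrier by (simp add: m_assoc[symmetric] m_comm[of "supp b"])
  then show "x \<in> denoms A a"
    unfolding mem_denoms_iff[OF ab(1)] using x r ab supp_carrier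
    by (intro conjI bexI[of _ "r \<otimes> supp a"]) simp_all
qed

text \<open>The support is itself a denominator, and it is divisible by all others; so it may serve as
  the only multiplier in the equality and the addition of fractions.\<close>

lemma section_eq_iff:
  assumes a: "a \<in> carrier A" and xy: "x \<in> carrier A" "y \<in> carrier A"
  shows "frac A (denoms A a) x \<one> = frac A (denoms A a) y \<one> \<longleftrightarrow> x \<otimes> supp a = y \<otimes> supp a"
proof -
  note S = mult_set_denoms[OF a]
  have "x \<otimes> supp a = y \<otimes> supp a" if u: "u \<in> denoms A a" "x \<otimes> u = y \<otimes> u" for u
  proof -
    obtain r where r: "u \<in> carrier A" "r \<in> carrier A" "u \<otimes> r = supp a"
      using u mem_denoms_iff[OF a] by blast
    have "x \<otimes> (u \<otimes> r) = y \<otimes> (u \<otimes> r)"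
      using u(2) r(1,2) xy by (simp add: m_assoc[symmetric])
    then show ?thesis by (simp add: r(3))
  qed
  then have "(\<exists>u\<in>denoms A a. x \<otimes> u = y \<otimes> u) \<longleftrightarrow> x \<otimes> supp a = y \<otimes> supp a"
    using supp_in_denoms[OF a] by blast
  then show ?thesis
    using frac_eq_iff[OF S xy mult_setD(2)[OF S] mult_setD(2)[OF S]] xy by simp
qed

lemma section_madd_iff:
  assumes a: "a \<in> carrier A" and xyz: "x \<in> carrier A" "y \<in> carrier A" "z \<in> carrier A"
  shows "frac A (denoms A a) x \<one> \<in>
      frac A (denoms A a) y \<one> \<boxplus>\<^bsub>sections A a\<^esub> frac A (denoms A a) z \<one> \<longleftrightarrow>
    x \<otimes> supp a \<in> (y \<otimes> supp a) \<boxplus> (z \<otimes> supp a)"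
proof -
  have "x \<otimes> supp a \<in> (y \<otimes> supp a) \<boxplus> (z \<otimes> supp a)"
    if u: "u \<in> denoms A a" "x \<otimes> u \<in> (y \<otimes> u) \<boxplus> (z \<otimes> u)" for u
  proof -
    obtain r where r: "u \<in> carrier A" "r \<in> carrier A" "u \<otimes> r = supp a"
      using u mem_denoms_iff[OF a] by blast
    have "x \<otimes> u \<otimes> r \<in> (y \<otimes> u \<otimes> r) \<boxplus> (z \<otimes> u \<otimes> r)"
      using madd_mult[OF _ _ _ r(2) u(2)] r(1) xyz by simp
    then show ?thesis using r xyz by (simp add: m_assoc)
  qed
  then show ?thesis
    unfolding sections_def frac_madd_iff[OF mult_set_denoms[OF a] xyz]
    using supp_in_denoms[OF a] by blast
qed

text \<open>If \<open>sr\<close> is the support, then \<open>r\<close> inverts \<open>s\<close> over \<open>D(a)\<close> and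
  \<open>y/s = yr/1\<close>.\<close>

lemma section_carrierE:
  assumes a: "a \<in> carrier A" and X: "X \<in> carrier (sections A a)"
  obtains x where "x \<in> carrier A" "X = frac A (denoms A a) x \<one>"
proof -
  note S = mult_set_denoms[OF a]
  obtain y s where y: "y \<in> carrier A" "s \<in> denoms A a" "X = frac A (denoms A a) y s"
    using X fractions_carrierE unfolding sections_def by metis
  obtain r where r: "s \<in> carrier A" "r \<in> carrier A" "s \<otimes> r = supp a"
    using y mem_denoms_iff[OF a] by blast
  have "y \<otimes> r \<otimes> s \<otimes> supp a = y \<otimes> ((s \<otimes> r) \<otimes> supp a)"
    using y(1) r(1,2) supp_carrier[OF a] by (simp add: m_ac)
  also have "\<dots> = y \<otimes> supp a"
    using r idem_mult_self[OF supp_idem[OF a]] by simp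
  finally have "y \<otimes> \<one> \<otimes> supp a = y \<otimes> r \<otimes> s \<otimes> supp a" using y by simp
  then have "X = frac A (denoms A a) (y \<otimes> r) \<one>"
    using frac_eq_iff[OF S y(1) _ y(2) mult_setD(2)[OF S], of "y \<otimes> r"] y r supp_in_denoms[OF a]
    by blast
  then show ?thesis using that y r by blast
qed

lemma section_closed:
  "\<lbrakk>a \<in> carrier A; x \<in> carrier A\<rbrakk> \<Longrightarrow> frac A (denoms A a) x \<one> \<in> carrier (sections A a)"
  using frac_carrier mult_setD(2)[OF mult_set_denoms] unfolding sections_def by auto

lemma restr_section:
  assumes ab: "a \<in> carrier A" "b \<in> carrier A" and sub: "supp a \<otimes> supp b = supp a"
    and x: "x \<in> carrier A"
  shows "restr A b a (frac A (denoms A b) x \<one>) = frac A (denoms A a) x \<one>"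
proof -
  note S = mult_set_denoms[OF ab(2)] and T = mult_set_denoms[OF ab(1)]
  note one = mult_setD(2)[OF S] mult_setD(2)[OF T]
  have eq: "frac A (denoms A a) y s = frac A (denoms A a) x \<one>"
    if ys: "(y, s) \<in> frac A (denoms A b) x \<one>" for y s
  proof -
    have ys': "y \<in> carrier A" "s \<in> denoms A b" "frac A (denoms A b) y s = frac A (denoms A b) x \<one>"
      using ys mem_frac_iff[OF S x one(1)] by auto
    then obtain u where "u \<in> denoms A b" "y \<otimes> \<one> \<otimes> u = x \<otimes> s \<otimes> u"
      using frac_eq_iff[OF S ys'(1) x ys'(2) one(1)] by blast
    then show ?thesis
      using frac_eq_iff[OF T ys'(1) x _ one(2)] denoms_mono[OF ab sub] ys'(2) by blast
  qed
  moreover have "(x, \<one>) \<in> frac A (denoms A b) x \<one>"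
    using mem_frac_iff[OF S x one(1)] x one(1) by blast
  ultimately show ?thesis unfolding restr_def by blast
qed

end

section \<open>Residue hyperfields\<close>

context von_neumann_hyperring
begin

context
  fixes p assumes p: "p \<in> spec A"
begin

lemma idem_mult_notin_prime: "\<lbrakk>idem e; e \<notin> p; idem f; f \<notin> p\<rbrakk> \<Longrightarrow> idem (e \<otimes> f) \<and> e \<otimes> f \<notin> p"
  using prime_mult_iff[OF p] idem_mult idem_carrier by auto

text \<open>The complement of the support of \<open>x\<close> kills \<open>x\<close> and, as \<open>x \<in> p\<close>, lies outside \<open>p\<close>.\<close>

lemma prime_element_killed:
  assumes x: "x \<in> p"
  shows "\<exists>e. idem e \<and> e \<notin> p \<and> x \<otimes> e = \<zero>"
proof -
  have xc: "x \<in> carrier A" using x mideal_carrier[OF prime_mideal[OF p]] by blast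
  show ?thesis
    using mult_compl_zero_iff[OF supp_idem[OF xc] xc] mult_supp[OF xc] idem_compl[OF supp_idem[OF xc]]
      compl_mem_prime_iff[OF p supp_idem[OF xc]] supp_mem_prime_iff[OF p xc] x by blast
qed

text \<open>Congruence modulo \<open>p\<close> is equality on some basic neighbourhood of \<open>p\<close>: an element of
  \<open>p \<inter> (a - b)\<close> is killed by an idempotent \<open>e\<close> outside \<open>p\<close>, which gives \<open>0 \<in> ae - be\<close>; conversely
  \<open>0 \<in> ae - be = (a - b)e\<close> gives an element of \<open>a - b\<close> killed by \<open>e\<close>, hence in \<open>p\<close>.\<close>

lemma quot_rel_iff:
  "(a, b) \<in> quot_rel A p \<longleftrightarrow> a \<in> carrier A \<and> b \<in> carrier A \<and>
    (\<exists>e. idem e \<and> e \<notin> p \<and> a \<otimes> e = b \<otimes> e)"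
proof -
  have "(a \<boxplus> (\<boxminus> b)) \<inter> p \<noteq> {} \<longleftrightarrow> (\<exists>e. idem e \<and> e \<notin> p \<and> a \<otimes> e = b \<otimes> e)" (is "?L \<longleftrightarrow> ?R")
    if ab: "a \<in> carrier A" "b \<in> carrier A"
  proof
    assume ?L
    then obtain x where x: "x \<in> a \<boxplus> (\<boxminus> b)" "x \<in> p" by blast
    obtain e where e: "idem e" "e \<notin> p" "x \<otimes> e = \<zero>" using prime_element_killed[OF x(2)] by blast
    have "x \<otimes> e \<in> (a \<otimes> e) \<boxplus> ((\<boxminus> b) \<otimes> e)"
      using madd_mult[OF madd_carrier[OF x(1)] _ _ _ x(1)] ab mneg_closed idem_carrier[OF e(1)] by blast
    then have "a \<otimes> e = b \<otimes> e"
      using e ab zero_in_diff_iff[of "a \<otimes> e" "b \<otimes> e"] idem_carrier neg_mult[of b e] by simp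
    then show ?R using e by blast
  next
    assume ?R
    then obtain e where e: "idem e" "e \<notin> p" "a \<otimes> e = b \<otimes> e" by blast
    have ec: "e \<in> carrier A" using e idem_carrier by simp
    have "\<zero> \<in> (a \<otimes> e) \<boxplus> ((\<boxminus> b) \<otimes> e)"
      using e ab zero_in_diff_iff[of "a \<otimes> e" "b \<otimes> e"] ec neg_mult[of b e] by auto
    then obtain x where x: "x \<in> a \<boxplus> (\<boxminus> b)" "\<zero> = x \<otimes> e"
      using madd_mult_lift[OF ab(1) mneg_closed[OF ab(2)] ec] by blast
    have "x \<in> p"
      using prime_mult_iff[OF p madd_carrier[OF x(1)] ec] x(2) e(2) ab mneg_closed
        mideal_zero[OF prime_mideal[OF p]] by auto
    then show ?L using x by blast
  qed
  then show ?thesis unfolding quot_rel_def by auto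
qed

lemma equiv_quot_rel: "equiv (carrier A) (quot_rel A p)"
proof (rule equivI)
  show "refl_on (carrier A) (quot_rel A p)"
    unfolding refl_on_def using quot_rel_iff idem_one one_notin_prime[OF p] by blast
  show "sym (quot_rel A p)"
    unfolding sym_def using quot_rel_iff by metis
  show "trans (quot_rel A p)"
  proof (rule transI)
    fix a b c assume "(a, b) \<in> quot_rel A p" "(b, c) \<in> quot_rel A p"
    then obtain e f where cl: "a \<in> carrier A" "b \<in> carrier A" "c \<in> carrier A" and
      ef: "idem e" "e \<notin> p" "idem f" "f \<notin> p" and eq: "a \<otimes> e = b \<otimes> e" "b \<otimes> f = c \<otimes> f"
      using quot_rel_iff by metis
    have efc: "e \<in> carrier A" "f \<in> carrier A" using ef idem_carrier by auto
    have "a \<otimes> (e \<otimes> f) = (a \<otimes> e) \<otimes> f" "c \<otimes> (e \<otimes> f) = (c \<otimes> f) \<otimes> e"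
      "b \<otimes> e \<otimes> f = b \<otimes> f \<otimes> e"
      using cl efc by (simp_all add: m_ac)
    then have "a \<otimes> (e \<otimes> f) = c \<otimes> (e \<otimes> f)" using eq by simp
    then show "(a, c) \<in> quot_rel A p"
      using quot_rel_iff cl idem_mult_notin_prime[OF ef] by blast
  qed
qed (auto simp: quot_rel_def)

lemma quot_class_eq_iff:
  assumes "a \<in> carrier A" "b \<in> carrier A"
  shows "quot_class A p a = quot_class A p b \<longleftrightarrow> (\<exists>e. idem e \<and> e \<notin> p \<and> a \<otimes> e = b \<otimes> e)"
  using eq_equiv_class_iff[OF equiv_quot_rel assms] quot_rel_iff assms
  unfolding quot_class_def by auto

lemma mem_quot_class_iff:
  assumes "a \<in> carrier A"
  shows "b \<in> quot_class A p a \<longleftrightarrow> b \<in> carrier A \<and> quot_class A p b = quot_class A p a"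
  using eq_equiv_class_iff[OF equiv_quot_rel assms, of b] quot_rel_iff[of a b]
  unfolding quot_class_def by auto

lemma quotient_carrier: "carrier (quotient_multiring A p) = quot_class A p ` carrier A"
  unfolding quotient_multiring_def quotient_def quot_class_def by auto

lemma quot_class_mult_cong:
  assumes "a \<in> carrier A" "b \<in> carrier A" "a' \<in> quot_class A p a" "b' \<in> quot_class A p b"
  shows "quot_class A p (a' \<otimes> b') = quot_class A p (a \<otimes> b)"
proof -
  have cl: "a' \<in> carrier A" "b' \<in> carrier A"
    using assms mem_quot_class_iff by auto
  obtain e f where ef: "idem e" "e \<notin> p" "idem f" "f \<notin> p"
    and eq: "a' \<otimes> e = a \<otimes> e" "b' \<otimes> f = b \<otimes> f"
    using assms mem_quot_class_iff quot_class_eq_iff cl by metis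
  have efc: "e \<in> carrier A" "f \<in> carrier A" using ef idem_carrier by auto
  have "a' \<otimes> b' \<otimes> (e \<otimes> f) = (a' \<otimes> e) \<otimes> (b' \<otimes> f)"
    "a \<otimes> b \<otimes> (e \<otimes> f) = (a \<otimes> e) \<otimes> (b \<otimes> f)"
    using assms(1,2) cl efc by (simp_all add: m_ac)
  then have "a' \<otimes> b' \<otimes> (e \<otimes> f) = a \<otimes> b \<otimes> (e \<otimes> f)" using eq by simp
  then show ?thesis
    using quot_class_eq_iff[of "a' \<otimes> b'" "a \<otimes> b"] assms cl idem_mult_notin_prime[OF ef] by auto
qed

lemma quot_class_mult:
  assumes ab: "a \<in> carrier A" "b \<in> carrier A"
  shows "quot_class A p a \<otimes>\<^bsub>quotient_multiring A p\<^esub> quot_class A p b = quot_class A p (a \<otimes> b)"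
proof -
  have "a \<in> quot_class A p a" "b \<in> quot_class A p b" using mem_quot_class_iff ab by auto
  then have "(\<Union>a'\<in>quot_class A p a. \<Union>b'\<in>quot_class A p b. quot_class A p (a' \<otimes> b')) =
      quot_class A p (a \<otimes> b)"
    using quot_class_mult_cong[OF ab] by blast
  then show ?thesis unfolding quotient_multiring_def by simp
qed

lemma quot_class_neg:
  assumes a: "a \<in> carrier A"
  shows "\<boxminus>\<^bsub>quotient_multiring A p\<^esub> quot_class A p a = quot_class A p (\<boxminus> a)"
proof -
  have "quot_class A p (\<boxminus> b) = quot_class A p (\<boxminus> a)" if b': "b \<in> quot_class A p a" for b
  proof -
    have b: "b \<in> carrier A" and eq: "quot_class A p b = quot_class A p a"
      using b' mem_quot_class_iff[OF a] by auto
    obtain e where e: "idem e" "e \<notin> p" "b \<otimes> e = a \<otimes> e"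
      using eq unfolding quot_class_eq_iff[OF b a] by blast
    have "(\<boxminus> b) \<otimes> e = (\<boxminus> a) \<otimes> e"
      using e(3) a b idem_carrier[OF e(1)] by (simp add: neg_mult)
    then show ?thesis
      unfolding quot_class_eq_iff[OF mneg_closed[OF b] mneg_closed[OF a]] using e by blast
  qed
  moreover have "a \<in> quot_class A p a" using mem_quot_class_iff a by auto
  ultimately have "(\<Union>b\<in>quot_class A p a. quot_class A p (\<boxminus> b)) = quot_class A p (\<boxminus> a)"
    by blast
  then show ?thesis unfolding quotient_multiring_def by simp
qed

text \<open>Each of the finitely many congruences modulo \<open>p\<close> in the definition of the sum becomes an
  equality on some neighbourhood of \<open>p\<close>; the sum holds in \<open>A\<close> on their intersection, given by
  the product of the idempotents.\<close>

lemma quot_class_madd_iff: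
  assumes abc: "a \<in> carrier A" "b \<in> carrier A" "c \<in> carrier A"
  shows "quot_class A p a \<in> quot_class A p b \<boxplus>\<^bsub>quotient_multiring A p\<^esub> quot_class A p c \<longleftrightarrow>
    (\<exists>e. idem e \<and> e \<notin> p \<and> a \<otimes> e \<in> (b \<otimes> e) \<boxplus> (c \<otimes> e))" (is "?L \<longleftrightarrow> ?R")
proof
  assume ?L
  then obtain a' b' c' i where mem: "quot_class A p a = quot_class A p a'" "a' \<in> carrier A"
    "b' \<in> quot_class A p b" "c' \<in> quot_class A p c" "i \<in> p" and
    sum: "a' \<in> set_madd A (b' \<boxplus> c') {i}"
    unfolding quotient_multiring_def by auto
  obtain x where x: "x \<in> b' \<boxplus> c'" "a' \<in> x \<boxplus> i" using sum unfolding set_madd_def by blast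
  have cl: "b' \<in> carrier A" "c' \<in> carrier A" "i \<in> carrier A"
    using mem mem_quot_class_iff abc mideal_carrier[OF prime_mideal[OF p]] by auto
  have xc: "x \<in> carrier A" using x cl madd_carrier by blast
  obtain e1 where e1: "idem e1" "e1 \<notin> p" "a \<otimes> e1 = a' \<otimes> e1"
    using mem(1) quot_class_eq_iff[OF abc(1) mem(2)] by auto
  obtain e2 where e2: "idem e2" "e2 \<notin> p" "b' \<otimes> e2 = b \<otimes> e2"
    using mem(3) mem_quot_class_iff[OF abc(2)] quot_class_eq_iff[OF cl(1) abc(2)] by auto
  obtain e3 where e3: "idem e3" "e3 \<notin> p" "c' \<otimes> e3 = c \<otimes> e3"
    using mem(4) mem_quot_class_iff[OF abc(3)] quot_class_eq_iff[OF cl(2) abc(3)] by auto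
  obtain e4 where e4: "idem e4" "e4 \<notin> p" "i \<otimes> e4 = \<zero>"
    using prime_element_killed[OF mem(5)] by auto
  define e where "e = e1 \<otimes> e2 \<otimes> (e3 \<otimes> e4)"
  have e: "idem e" "e \<notin> p"
    using e1 e2 e3 e4 idem_mult_notin_prime unfolding e_def by auto
  have ec: "e \<in> carrier A" "e1 \<in> carrier A" "e2 \<in> carrier A" "e3 \<in> carrier A" "e4 \<in> carrier A"
    using e e1 e2 e3 e4 idem_carrier by auto
  have "a \<otimes> e = (a \<otimes> e1) \<otimes> (e2 \<otimes> e3 \<otimes> e4)" "a' \<otimes> e = (a' \<otimes> e1) \<otimes> (e2 \<otimes> e3 \<otimes> e4)"
    "b \<otimes> e = (b \<otimes> e2) \<otimes> (e1 \<otimes> e3 \<otimes> e4)" "b' \<otimes> e = (b' \<otimes> e2) \<otimes> (e1 \<otimes> e3 \<otimes> e4)"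
    "c \<otimes> e = (c \<otimes> e3) \<otimes> (e1 \<otimes> e2 \<otimes> e4)" "c' \<otimes> e = (c' \<otimes> e3) \<otimes> (e1 \<otimes> e2 \<otimes> e4)"
    "i \<otimes> e = (i \<otimes> e4) \<otimes> (e1 \<otimes> e2 \<otimes> e3)"
    using ec abc cl mem(2) unfolding e_def by (simp_all add: m_ac)
  then have eq: "a \<otimes> e = a' \<otimes> e" "b' \<otimes> e = b \<otimes> e" "c' \<otimes> e = c \<otimes> e" "i \<otimes> e = \<zero>"
    using e1 e2 e3 e4 ec zero_mult by auto
  have "a' \<otimes> e \<in> (x \<otimes> e) \<boxplus> (i \<otimes> e)"
    using madd_mult[OF mem(2) xc cl(3) ec(1) x(2)] .
  then have "a' \<otimes> e = x \<otimes> e" using madd_zero eq(4) mem(2) xc ec by simp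
  moreover have "x \<otimes> e \<in> (b' \<otimes> e) \<boxplus> (c' \<otimes> e)"
    using madd_mult[OF xc cl(1,2) ec(1) x(1)] .
  ultimately show ?R using e eq by auto
next
  assume ?R
  then obtain e where e: "idem e" "e \<notin> p" "a \<otimes> e \<in> (b \<otimes> e) \<boxplus> (c \<otimes> e)" by blast
  then obtain x where x: "x \<in> b \<boxplus> c" "a \<otimes> e = x \<otimes> e"
    using madd_mult_lift[OF abc(2,3) idem_carrier] by blast
  have xc: "x \<in> carrier A" using x abc madd_carrier by blast
  have "quot_class A p a = quot_class A p x"
    using quot_class_eq_iff[OF abc(1) xc] e x by blast
  moreover have "x \<in> set_madd A (b \<boxplus> c) {\<zero>}"
    unfolding set_madd_def using x xc madd_zero by auto
  moreover have "b \<in> quot_class A p b" "c \<in> quot_class A p c" using mem_quot_class_iff abc by auto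
  ultimately have "\<exists>x. quot_class A p a = quot_class A p x \<and> x \<in> carrier A \<and>
      (\<exists>b'\<in>quot_class A p b. \<exists>c'\<in>quot_class A p c. \<exists>i\<in>p. x \<in> set_madd A (b' \<boxplus> c') {i})"
    using xc mideal_zero[OF prime_mideal[OF p]] by blast
  then show ?L
    by (simp only: quotient_multiring_def multiring.simps mem_Collect_eq)
qed

lemma quot_madd_subset:
  assumes "X \<in> Y \<boxplus>\<^bsub>quotient_multiring A p\<^esub> Z"
  shows "X \<in> carrier (quotient_multiring A p)"
  using assms unfolding quotient_carrier by (auto simp: quotient_multiring_def)

lemma quot_class_madd_mono:
  assumes abc: "a \<in> carrier A" "b \<in> carrier A" "c \<in> carrier A" "a \<in> b \<boxplus> c"
  shows "quot_class A p a \<in> quot_class A p b \<boxplus>\<^bsub>quotient_multiring A p\<^esub> quot_class A p c"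
  using quot_class_madd_iff[OF abc(1-3)] idem_one one_notin_prime[OF p] abc by auto

text \<open>By the preceding description every relation in \<open>A/p\<close> is one in \<open>A\<close> after multiplication by
  an idempotent outside \<open>p\<close>, and such idempotents are closed under products; the axioms are
  inherited from \<open>A\<close>.\<close>

lemma multiring_quotient: "multiring (quotient_multiring A p)"
proof -
  define Q where "Q = quotient_multiring A p"
  define cl where "cl = quot_class A p"
  have carr: "carrier Q = cl ` carrier A" unfolding Q_def cl_def by (rule quotient_carrier)
  have clc: "a \<in> carrier A \<Longrightarrow> cl a \<in> carrier Q" for a using carr by blast
  have one: "\<one>\<^bsub>Q\<^esub> = cl \<one>" and zero: "\<zero>\<^bsub>Q\<^esub> = cl \<zero>"
    unfolding Q_def cl_def quotient_multiring_def by simp_all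
  have mult: "cl a \<otimes>\<^bsub>Q\<^esub> cl b = cl (a \<otimes> b)" if "a \<in> carrier A" "b \<in> carrier A" for a b
    unfolding Q_def cl_def using that by (rule quot_class_mult)
  have neg: "\<boxminus>\<^bsub>Q\<^esub> cl a = cl (\<boxminus> a)" if "a \<in> carrier A" for a
    unfolding Q_def cl_def using that by (rule quot_class_neg)
  have sum: "cl a \<in> cl b \<boxplus>\<^bsub>Q\<^esub> cl c \<longleftrightarrow>
      (\<exists>e. idem e \<and> e \<notin> p \<and> a \<otimes> e \<in> (b \<otimes> e) \<boxplus> (c \<otimes> e))"
    if "a \<in> carrier A" "b \<in> carrier A" "c \<in> carrier A" for a b c
    unfolding Q_def cl_def using that by (rule quot_class_madd_iff)
  have sub: "X \<in> carrier Q" if "X \<in> Y \<boxplus>\<^bsub>Q\<^esub> Z" for X Y Z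
    using that unfolding Q_def by (rule quot_madd_subset)
  have mono: "cl a \<in> cl b \<boxplus>\<^bsub>Q\<^esub> cl c"
    if "a \<in> carrier A" "b \<in> carrier A" "c \<in> carrier A" "a \<in> b \<boxplus> c" for a b c
    unfolding Q_def cl_def using that by (rule quot_class_madd_mono)
  have ex: "\<exists>a\<in>carrier A. X = cl a" if "X \<in> carrier Q" for X
    using that carr by blast
  have "comm_monoid Q"
  proof (rule comm_monoidI)
    fix X Y Z assume X: "X \<in> carrier Q" and Y: "Y \<in> carrier Q"
    show "X \<otimes>\<^bsub>Q\<^esub> Y \<in> carrier Q"
      using ex[OF X] ex[OF Y] by (auto simp: mult clc)
    show "X \<otimes>\<^bsub>Q\<^esub> Y = Y \<otimes>\<^bsub>Q\<^esub> X"
      using ex[OF X] ex[OF Y] by (auto simp: mult m_comm)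
    assume Z: "Z \<in> carrier Q"
    show "X \<otimes>\<^bsub>Q\<^esub> Y \<otimes>\<^bsub>Q\<^esub> Z = X \<otimes>\<^bsub>Q\<^esub> (Y \<otimes>\<^bsub>Q\<^esub> Z)"
      using ex[OF X] ex[OF Y] ex[OF Z] by (auto simp: mult m_assoc)
  next
    show "\<one>\<^bsub>Q\<^esub> \<in> carrier Q" by (simp add: one clc)
    show "\<one>\<^bsub>Q\<^esub> \<otimes>\<^bsub>Q\<^esub> X = X" if "X \<in> carrier Q" for X
      using ex[OF that] by (auto simp: mult one)
  qed
  moreover have "multiring_axioms Q"
  proof
    show "\<zero>\<^bsub>Q\<^esub> \<in> carrier Q" by (simp add: zero clc mzero_closed)
    fix X assume X: "X \<in> carrier Q"
    then obtain x where x: "x \<in> carrier A" "X = cl x" using ex[OF X] by blast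
    show "\<boxminus>\<^bsub>Q\<^esub> X \<in> carrier Q" using x by (simp add: neg clc mneg_closed)
    show "X \<otimes>\<^bsub>Q\<^esub> \<zero>\<^bsub>Q\<^esub> = \<zero>\<^bsub>Q\<^esub>" using x by (simp add: zero mult mzero_closed mult_zero)
    fix Y assume Y: "Y \<in> carrier Q"
    then obtain y where y: "y \<in> carrier A" "Y = cl y" using ex[OF Y] by blast
    show "X \<boxplus>\<^bsub>Q\<^esub> Y \<subseteq> carrier Q" using sub by blast
    show "X \<boxplus>\<^bsub>Q\<^esub> Y \<noteq> {}"
    proof -
      obtain z where "z \<in> x \<boxplus> y" using madd_nonempty[OF x(1) y(1)] by blast
      then show ?thesis using mono[of z x y] madd_carrier x y by blast
    qed
    show "X \<in> Y \<boxplus>\<^bsub>Q\<^esub> \<zero>\<^bsub>Q\<^esub> \<longleftrightarrow> X = Y"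
    proof -
      have "x \<otimes> e \<in> (y \<otimes> e) \<boxplus> (\<zero> \<otimes> e) \<longleftrightarrow> x \<otimes> e = y \<otimes> e" if "idem e" for e
        using that x y by (simp add: idem_carrier zero_mult madd_zero)
      then have "(\<exists>e. idem e \<and> e \<notin> p \<and> x \<otimes> e \<in> (y \<otimes> e) \<boxplus> (\<zero> \<otimes> e)) \<longleftrightarrow>
          (\<exists>e. idem e \<and> e \<notin> p \<and> x \<otimes> e = y \<otimes> e)"
        by (intro ex_cong1 conj_cong refl)
      also have "\<dots> \<longleftrightarrow> cl x = cl y"
        unfolding cl_def quot_class_eq_iff[OF x(1) y(1)] ..
      finally show ?thesis
        unfolding zero x(2) y(2) sum[OF x(1) y(1) mzero_closed] .
    qed
    have comm: "U \<boxplus>\<^bsub>Q\<^esub> V \<subseteq> V \<boxplus>\<^bsub>Q\<^esub> U" if UV: "U \<in> carrier Q" "V \<in> carrier Q" for U V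
    proof
      fix W assume W: "W \<in> U \<boxplus>\<^bsub>Q\<^esub> V"
      obtain u where u: "u \<in> carrier A" "U = cl u" using ex[OF UV(1)] by blast
      obtain v where v: "v \<in> carrier A" "V = cl v" using ex[OF UV(2)] by blast
      obtain w where w: "w \<in> carrier A" "W = cl w" using ex[OF sub[OF W]] by blast
      obtain e where e: "idem e" "e \<notin> p" "w \<otimes> e \<in> (u \<otimes> e) \<boxplus> (v \<otimes> e)"
        using W unfolding u(2) v(2) w(2) sum[OF w(1) u(1) v(1)] by blast
      have "w \<otimes> e \<in> (v \<otimes> e) \<boxplus> (u \<otimes> e)"
        using e(3) madd_comm[of "u \<otimes> e" "v \<otimes> e"] idem_carrier[OF e(1)] u v by simp
      then show "W \<in> V \<boxplus>\<^bsub>Q\<^esub> U"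
        using e unfolding u(2) v(2) w(2) sum[OF w(1) v(1) u(1)] by blast
    qed
    then show "X \<boxplus>\<^bsub>Q\<^esub> Y = Y \<boxplus>\<^bsub>Q\<^esub> X" using X Y by blast
    fix Z assume Z: "Z \<in> carrier Q"
    then obtain z where z: "z \<in> carrier A" "Z = cl z" using ex[OF Z] by blast
    show "Z \<in> \<boxminus>\<^bsub>Q\<^esub> Y \<boxplus>\<^bsub>Q\<^esub> X \<and> Y \<in> X \<boxplus>\<^bsub>Q\<^esub> \<boxminus>\<^bsub>Q\<^esub> Z" if XYZ: "X \<in> Y \<boxplus>\<^bsub>Q\<^esub> Z"
    proof -
      obtain e where e: "idem e" "e \<notin> p" "x \<otimes> e \<in> (y \<otimes> e) \<boxplus> (z \<otimes> e)"
        using XYZ unfolding x(2) y(2) z(2) sum[OF x(1) y(1) z(1)] by blast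
      have "z \<otimes> e \<in> ((\<boxminus> y) \<otimes> e) \<boxplus> (x \<otimes> e) \<and> y \<otimes> e \<in> (x \<otimes> e) \<boxplus> ((\<boxminus> z) \<otimes> e)"
        using madd_reversible[OF _ _ _ e(3)] e x y z idem_carrier neg_mult by simp
      then show ?thesis
        unfolding x(2) y(2) z(2) neg[OF y(1)] neg[OF z(1)]
          sum[OF z(1) mneg_closed[OF y(1)] x(1)] sum[OF y(1) x(1) mneg_closed[OF z(1)]]
        using e by blast
    qed
    fix W assume W: "W \<in> carrier Q"
    then obtain w where w: "w \<in> carrier A" "W = cl w" using ex[OF W] by blast
    show "X \<otimes>\<^bsub>Q\<^esub> W \<in> (Y \<otimes>\<^bsub>Q\<^esub> W) \<boxplus>\<^bsub>Q\<^esub> (Z \<otimes>\<^bsub>Q\<^esub> W)" if XYZ: "X \<in> Y \<boxplus>\<^bsub>Q\<^esub> Z"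
    proof -
      obtain e where e: "idem e" "e \<notin> p" "x \<otimes> e \<in> (y \<otimes> e) \<boxplus> (z \<otimes> e)"
        using XYZ unfolding x(2) y(2) z(2) sum[OF x(1) y(1) z(1)] by blast
      have "x \<otimes> e \<otimes> w \<in> (y \<otimes> e \<otimes> w) \<boxplus> (z \<otimes> e \<otimes> w)"
        using madd_mult[OF _ _ _ w(1) e(3)] x y z e idem_carrier by simp
      moreover have "t \<otimes> e \<otimes> w = t \<otimes> w \<otimes> e" if "t \<in> carrier A" for t
        using that w e idem_carrier by (simp add: m_ac)
      ultimately have "x \<otimes> w \<otimes> e \<in> (y \<otimes> w \<otimes> e) \<boxplus> (z \<otimes> w \<otimes> e)" using x y z by simp
      then show ?thesis
        unfolding x(2) y(2) z(2) w(2) mult[OF x(1) w(1)] mult[OF y(1) w(1)] mult[OF z(1) w(1)]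
          sum[OF m_closed[OF x(1) w(1)] m_closed[OF y(1) w(1)] m_closed[OF z(1) w(1)]]
        using e by blast
    qed
    fix G V assume G: "G \<in> X \<boxplus>\<^bsub>Q\<^esub> Y" and V: "V \<in> G \<boxplus>\<^bsub>Q\<^esub> Z"
    obtain g where g: "g \<in> carrier A" "G = cl g" using ex[OF sub[OF G]] by blast
    obtain v where v: "v \<in> carrier A" "V = cl v" using ex[OF sub[OF V]] by blast
    obtain e where e: "idem e" "e \<notin> p" "g \<otimes> e \<in> (x \<otimes> e) \<boxplus> (y \<otimes> e)"
      using G unfolding x(2) y(2) g(2) sum[OF g(1) x(1) y(1)] by blast
    obtain f where f: "idem f" "f \<notin> p" "v \<otimes> f \<in> (g \<otimes> f) \<boxplus> (z \<otimes> f)"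
      using V unfolding v(2) g(2) z(2) sum[OF v(1) g(1) z(1)] by blast
    have ec: "e \<in> carrier A" "f \<in> carrier A" using e f idem_carrier by auto
    have "g \<otimes> e \<otimes> f \<in> (x \<otimes> e \<otimes> f) \<boxplus> (y \<otimes> e \<otimes> f)"
      using madd_mult[OF _ _ _ _ e(3)] x y g ec by simp
    then have 1: "g \<otimes> (e \<otimes> f) \<in> (x \<otimes> (e \<otimes> f)) \<boxplus> (y \<otimes> (e \<otimes> f))"
      using x y g ec by (simp add: m_assoc)
    have "v \<otimes> f \<otimes> e \<in> (g \<otimes> f \<otimes> e) \<boxplus> (z \<otimes> f \<otimes> e)"
      using madd_mult[OF _ _ _ _ f(3)] v z g ec by simp
    then have 2: "v \<otimes> (e \<otimes> f) \<in> (g \<otimes> (e \<otimes> f)) \<boxplus> (z \<otimes> (e \<otimes> f))"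
      using z v g ec by (simp add: m_ac)
    obtain h where h: "h \<in> (y \<otimes> (e \<otimes> f)) \<boxplus> (z \<otimes> (e \<otimes> f))" "v \<otimes> (e \<otimes> f) \<in> (x \<otimes> (e \<otimes> f)) \<boxplus> h"
      using madd_assoc[OF _ _ _ 1 2] x y z ec by auto
    obtain k where k: "k \<in> y \<boxplus> z" "h = k \<otimes> (e \<otimes> f)"
      using madd_mult_lift[OF y(1) z(1) _ h(1)] ec by auto
    have kc: "k \<in> carrier A" using k y z madd_carrier by blast
    have "cl k \<in> Y \<boxplus>\<^bsub>Q\<^esub> Z" using mono[OF kc y(1) z(1) k(1)] y z by simp
    moreover have "V \<in> X \<boxplus>\<^bsub>Q\<^esub> cl k"
      unfolding v(2) x(2) sum[OF v(1) x(1) kc]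
      using h(2) idem_mult_notin_prime[OF e(1,2) f(1,2)] unfolding k(2) by blast
    ultimately show "\<exists>H\<in>Y \<boxplus>\<^bsub>Q\<^esub> Z. V \<in> X \<boxplus>\<^bsub>Q\<^esub> H" by blast
  qed
  ultimately show ?thesis
    unfolding Q_def by (rule multiring.intro)
qed

lemma quot_class_zero_iff:
  assumes a: "a \<in> carrier A"
  shows "quot_class A p a = \<zero>\<^bsub>quotient_multiring A p\<^esub> \<longleftrightarrow> a \<in> p"
proof -
  have "a \<in> p" if "idem e" "e \<notin> p" "a \<otimes> e = \<zero> \<otimes> e" for e
    using prime_mult_iff[OF p a, of e] that idem_carrier mideal_zero[OF prime_mideal[OF p]]
    by (simp add: zero_mult)
  moreover have "\<exists>e. idem e \<and> e \<notin> p \<and> a \<otimes> e = \<zero> \<otimes> e" if "a \<in> p"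
    using prime_element_killed[OF that] idem_carrier zero_mult by auto
  ultimately show ?thesis
    using quot_class_eq_iff[OF a mzero_closed] by (auto simp: quotient_multiring_def)
qed

lemma mem_nonzero_quotient_iff:
  "X \<in> nonzero (quotient_multiring A p) \<longleftrightarrow> (\<exists>x\<in>carrier A. x \<notin> p \<and> X = quot_class A p x)"
  unfolding nonzero_def quotient_carrier using quot_class_zero_iff by auto

lemma mult_set_nonzero_quotient:
  "mult_set (quotient_multiring A p) (nonzero (quotient_multiring A p))"
  unfolding mult_set_def
proof (intro conjI ballI)
  show "nonzero (quotient_multiring A p) \<subseteq> carrier (quotient_multiring A p)"
    by (simp add: nonzero_def)
  have "\<one>\<^bsub>quotient_multiring A p\<^esub> = quot_class A p \<one>" by (simp add: quotient_multiring_def)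
  then show "\<one>\<^bsub>quotient_multiring A p\<^esub> \<in> nonzero (quotient_multiring A p)"
    using mem_nonzero_quotient_iff one_notin_prime[OF p] one_closed by metis
  fix X Y assume "X \<in> nonzero (quotient_multiring A p)" "Y \<in> nonzero (quotient_multiring A p)"
  then obtain x y where xy: "x \<in> carrier A" "x \<notin> p" "X = quot_class A p x"
    "y \<in> carrier A" "y \<notin> p" "Y = quot_class A p y"
    using mem_nonzero_quotient_iff by auto
  then have "x \<otimes> y \<in> carrier A" "x \<otimes> y \<notin> p" "X \<otimes>\<^bsub>quotient_multiring A p\<^esub> Y = quot_class A p (x \<otimes> y)"
    using prime_mult_iff[OF p] quot_class_mult by auto
  then show "X \<otimes>\<^bsub>quotient_multiring A p\<^esub> Y \<in> nonzero (quotient_multiring A p)"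
    using mem_nonzero_quotient_iff by blast
qed

text \<open>A nonzero multiplier in \<open>A/p\<close> is represented by some \<open>x \<notin> p\<close>, which divides its support;
  that support is an idempotent outside \<open>p\<close> and can replace \<open>x\<close>.\<close>

lemma to_residue_madd_iff:
  assumes abc: "a \<in> carrier A" "b \<in> carrier A" "c \<in> carrier A"
  shows "to_residue A p a \<in> to_residue A p b \<boxplus>\<^bsub>residue A p\<^esub> to_residue A p c \<longleftrightarrow>
    (\<exists>e. idem e \<and> e \<notin> p \<and> a \<otimes> e \<in> (b \<otimes> e) \<boxplus> (c \<otimes> e))" (is "?L \<longleftrightarrow> ?R")
proof -
  interpret Q: multiring "quotient_multiring A p" by (rule multiring_quotient)
  have "?L \<longleftrightarrow> (\<exists>V\<in>nonzero (quotient_multiring A p).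
      quot_class A p a \<otimes>\<^bsub>quotient_multiring A p\<^esub> V \<in>
        (quot_class A p b \<otimes>\<^bsub>quotient_multiring A p\<^esub> V) \<boxplus>\<^bsub>quotient_multiring A p\<^esub>
        (quot_class A p c \<otimes>\<^bsub>quotient_multiring A p\<^esub> V))"
    unfolding to_residue_def residue_def
    using abc by (intro Q.frac_madd_iff mult_set_nonzero_quotient) (auto simp: quotient_carrier)
  also have "\<dots> \<longleftrightarrow> (\<exists>x\<in>carrier A. x \<notin> p \<and>
      quot_class A p (a \<otimes> x) \<in>
        quot_class A p (b \<otimes> x) \<boxplus>\<^bsub>quotient_multiring A p\<^esub> quot_class A p (c \<otimes> x))"
    unfolding Bex_def mem_nonzero_quotient_iff using quot_class_mult abc
    by (metis (no_types, lifting))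
  also have "\<dots> \<longleftrightarrow> (\<exists>x\<in>carrier A. x \<notin> p \<and> (\<exists>e. idem e \<and> e \<notin> p \<and>
      a \<otimes> x \<otimes> e \<in> (b \<otimes> x \<otimes> e) \<boxplus> (c \<otimes> x \<otimes> e)))"
    using abc by (intro bex_cong refl conj_cong quot_class_madd_iff) auto
  also have "\<dots> \<longleftrightarrow> ?R"
  proof
    assume ?R
    then show "\<exists>x\<in>carrier A. x \<notin> p \<and> (\<exists>e. idem e \<and> e \<notin> p \<and>
        a \<otimes> x \<otimes> e \<in> (b \<otimes> x \<otimes> e) \<boxplus> (c \<otimes> x \<otimes> e))"
      using one_notin_prime[OF p] abc by (intro bexI[of _ \<one>]) simp_all
  next
    assume "\<exists>x\<in>carrier A. x \<notin> p \<and> (\<exists>e. idem e \<and> e \<notin> p \<and>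
        a \<otimes> x \<otimes> e \<in> (b \<otimes> x \<otimes> e) \<boxplus> (c \<otimes> x \<otimes> e))"
    then obtain x e where x: "x \<in> carrier A" "x \<notin> p" and e: "idem e" "e \<notin> p" and
      sum: "a \<otimes> x \<otimes> e \<in> (b \<otimes> x \<otimes> e) \<boxplus> (c \<otimes> x \<otimes> e)" by blast
    have ec: "e \<in> carrier A" using e idem_carrier by simp
    obtain r where r: "r \<in> carrier A" "x \<otimes> r = supp x" using supp_factor[OF x(1)] .
    have "a \<otimes> x \<otimes> e \<otimes> r \<in> (b \<otimes> x \<otimes> e \<otimes> r) \<boxplus> (c \<otimes> x \<otimes> e \<otimes> r)"
      using madd_mult[OF _ _ _ r(1) sum] abc x ec by simp
    moreover have "t \<otimes> x \<otimes> e \<otimes> r = t \<otimes> (supp x \<otimes> e)" if "t \<in> carrier A" for t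
      using that x(1) ec r(1) by (simp add: r(2)[symmetric] m_ac)
    ultimately have "a \<otimes> (supp x \<otimes> e) \<in> (b \<otimes> (supp x \<otimes> e)) \<boxplus> (c \<otimes> (supp x \<otimes> e))"
      using abc by simp
    then show ?R
      using idem_mult_notin_prime[OF supp_idem[OF x(1)] _ e] supp_mem_prime_iff[OF p x(1)] x(2)
      by blast
  qed
  finally show ?thesis .
qed

lemma to_residue_eq_if_locally_eq:
  assumes ab: "a \<in> carrier A" "b \<in> carrier A" and e: "idem e" "e \<notin> p" "a \<otimes> e = b \<otimes> e"
  shows "to_residue A p a = to_residue A p b"
  using quot_class_eq_iff[OF ab] e unfolding to_residue_def by metis

lemma one_residue: "\<one>\<^bsub>residue A p\<^esub> = to_residue A p \<one>"
  by (simp add: residue_def to_residue_def fractions_def quotient_multiring_def)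

end

end

section \<open>Gluing along idempotents\<close>

context von_neumann_hyperring
begin

definition idem_sums_trivial :: bool where
  "idem_sums_trivial \<longleftrightarrow> (\<forall>e. idem e \<longrightarrow> e \<boxplus> compl e = {\<one>})"

lemma idem_sums_trivialI:
  assumes "\<And>e u. \<lbrakk>idem e; u \<in> e \<boxplus> compl e\<rbrakk> \<Longrightarrow> u = \<one>"
  shows idem_sums_trivial
  unfolding idem_sums_trivial_def
proof (intro allI impI equalityI subsetI)
  fix e u assume "idem e"
  show "u \<in> {\<one>}" if "u \<in> e \<boxplus> compl e" using assms[OF \<open>idem e\<close> that] by simp
  show "u \<in> e \<boxplus> compl e" if "u \<in> {\<one>}" using one_in_idem_compl[OF \<open>idem e\<close>] that by simp
qed

text \<open>By the hyperring axiom \<open>xe + xe' = (e + e')x\<close>, where \<open>e'\<close> is the complement of \<open>e\<close>. Hence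
  the pieces of \<open>x\<close> determine \<open>x\<close>.\<close>

lemma decompose_along_eq:
  assumes t: idem_sums_trivial and e: "idem e" and x: "x \<in> carrier A"
  shows "(x \<otimes> e) \<boxplus> (x \<otimes> compl e) = {x}"
proof -
  have ec: "e \<in> carrier A" "compl e \<in> carrier A" using e idem_carrier compl_carrier by auto
  show ?thesis
  proof (rule equalityI; rule subsetI)
    fix z assume "z \<in> (x \<otimes> e) \<boxplus> (x \<otimes> compl e)"
    then have "z \<in> (e \<otimes> x) \<boxplus> (compl e \<otimes> x)" using x ec by (simp add: m_comm)
    then obtain a where "a \<in> e \<boxplus> compl e" "z = a \<otimes> x"
      using madd_mult_lift[OF ec x] by blast
    then show "z \<in> {x}" using t e x unfolding idem_sums_trivial_def by simp
  qed (use decompose_along[OF e x] in simp)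
qed

lemma eq_if_piecewise_eq:
  assumes t: idem_sums_trivial and e: "idem e" and xy: "x \<in> carrier A" "y \<in> carrier A"
    and eq: "x \<otimes> e = y \<otimes> e" "x \<otimes> compl e = y \<otimes> compl e"
  shows "x = y"
proof -
  have "{x} = {y}"
    using decompose_along_eq[OF t e xy(1)] unfolding eq decompose_along_eq[OF t e xy(2)] by (rule sym)
  then show ?thesis by simp
qed

text \<open>Regroup: \<open>x\<close> lies in \<open>(ye + ze) + (ye' + ze') = (ye + ye') + (ze + ze') = y + z\<close>, where
  \<open>e'\<close> is the complement of \<open>e\<close>.\<close>

lemma madd_if_piecewise_madd:
  assumes t: idem_sums_trivial and e: "idem e"
    and xyz: "x \<in> carrier A" "y \<in> carrier A" "z \<in> carrier A"
    and sum: "x \<otimes> e \<in> (y \<otimes> e) \<boxplus> (z \<otimes> e)" "x \<otimes> compl e \<in> (y \<otimes> compl e) \<boxplus> (z \<otimes> compl e)"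
  shows "x \<in> y \<boxplus> z"
proof -
  have ec: "e \<in> carrier A" "compl e \<in> carrier A" using e idem_carrier compl_carrier by auto
  obtain u v where "u \<in> (y \<otimes> e) \<boxplus> (y \<otimes> compl e)" "v \<in> (z \<otimes> e) \<boxplus> (z \<otimes> compl e)" "x \<in> u \<boxplus> v"
    using madd_interchange[OF _ _ _ _ sum decompose_along[OF e xyz(1)]] xyz ec by auto
  then show ?thesis
    using decompose_along_eq[OF t e] xyz by simp
qed

lemma madd_local:
  assumes t: idem_sums_trivial and abc: "a \<in> carrier A" "b \<in> carrier A" "c \<in> carrier A"
    and e: "idem e"
    and local: "\<And>p. \<lbrakk>p \<in> spec A; e \<notin> p\<rbrakk> \<Longrightarrow>
      \<exists>f. idem f \<and> f \<notin> p \<and> a \<otimes> f \<in> (b \<otimes> f) \<boxplus> (c \<otimes> f)"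
  shows "a \<otimes> e \<in> (b \<otimes> e) \<boxplus> (c \<otimes> e)"
  using _ _ _ e local
proof (rule idem_local_induct)
  show "a \<otimes> \<zero> \<in> (b \<otimes> \<zero>) \<boxplus> (c \<otimes> \<zero>)"
    using abc mzero_closed by (simp add: mult_zero madd_zero)
next
  fix g h assume gh: "idem g" "idem h" and P: "a \<otimes> g \<in> (b \<otimes> g) \<boxplus> (c \<otimes> g)"
  have "a \<otimes> g \<otimes> h \<in> (b \<otimes> g \<otimes> h) \<boxplus> (c \<otimes> g \<otimes> h)"
    using madd_mult[OF _ _ _ _ P] gh abc idem_carrier by simp
  then show "a \<otimes> (g \<otimes> h) \<in> (b \<otimes> (g \<otimes> h)) \<boxplus> (c \<otimes> (g \<otimes> h))"
    using gh abc idem_carrier by (simp add: m_assoc)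
next
  fix g h assume gh: "idem g" "idem h"
    and P: "a \<otimes> (g \<otimes> h) \<in> (b \<otimes> (g \<otimes> h)) \<boxplus> (c \<otimes> (g \<otimes> h))"
      "a \<otimes> (g \<otimes> compl h) \<in> (b \<otimes> (g \<otimes> compl h)) \<boxplus> (c \<otimes> (g \<otimes> compl h))"
  then show "a \<otimes> g \<in> (b \<otimes> g) \<boxplus> (c \<otimes> g)"
    using madd_if_piecewise_madd[OF t gh(2), of "a \<otimes> g" "b \<otimes> g" "c \<otimes> g"] abc idem_carrier
      compl_carrier by (simp add: m_assoc)
qed

text \<open>Partial gluings over \<open>gh\<close> and over \<open>g\<close> times the complement of \<open>h\<close> are combined by choosing
  any element with these two pieces; that it restricts to the given \<open>x i\<close> is an equality, which
  may be checked on the pieces. Near a prime where some \<open>s i\<close> does not vanish, \<open>x i\<close> itself is a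
  gluing, by compatibility.\<close>

lemma glue_local:
  assumes t: idem_sums_trivial
    and s: "\<And>i. i \<in> I \<Longrightarrow> idem (s i)" and x: "\<And>i. i \<in> I \<Longrightarrow> x i \<in> carrier A"
    and compat: "\<And>i j. \<lbrakk>i \<in> I; j \<in> I\<rbrakk> \<Longrightarrow> x i \<otimes> (s i \<otimes> s j) = x j \<otimes> (s i \<otimes> s j)"
    and e: "idem e" and cover: "\<And>p. \<lbrakk>p \<in> spec A; e \<notin> p\<rbrakk> \<Longrightarrow> \<exists>i\<in>I. s i \<notin> p"
  shows "\<exists>y\<in>carrier A. \<forall>i\<in>I. y \<otimes> (e \<otimes> s i) = x i \<otimes> (e \<otimes> s i)"
  using _ _ _ e
proof (rule idem_local_induct)
  show "\<exists>y\<in>carrier A. \<forall>i\<in>I. y \<otimes> (\<zero> \<otimes> s i) = x i \<otimes> (\<zero> \<otimes> s i)"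
    using s x idem_carrier by (intro bexI[of _ \<zero>]) (simp_all add: zero_mult mult_zero mzero_closed)
next
  fix g h assume gh: "idem g" "idem h"
    and "\<exists>y\<in>carrier A. \<forall>i\<in>I. y \<otimes> (g \<otimes> s i) = x i \<otimes> (g \<otimes> s i)"
  then obtain y where y: "y \<in> carrier A" "\<And>i. i \<in> I \<Longrightarrow> y \<otimes> (g \<otimes> s i) = x i \<otimes> (g \<otimes> s i)"
    by blast
  have "y \<otimes> (g \<otimes> h \<otimes> s i) = x i \<otimes> (g \<otimes> h \<otimes> s i)" if i: "i \<in> I" for i
  proof -
    have "t \<otimes> (g \<otimes> h \<otimes> s i) = t \<otimes> (g \<otimes> s i) \<otimes> h" if "t \<in> carrier A" for t
      using that gh s[OF i] idem_carrier by (simp add: m_ac)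
    then show ?thesis using y i x by simp
  qed
  then show "\<exists>y\<in>carrier A. \<forall>i\<in>I. y \<otimes> (g \<otimes> h \<otimes> s i) = x i \<otimes> (g \<otimes> h \<otimes> s i)"
    using y by blast
next
  fix g h assume gh: "idem g" "idem h"
    and "\<exists>y\<in>carrier A. \<forall>i\<in>I. y \<otimes> (g \<otimes> h \<otimes> s i) = x i \<otimes> (g \<otimes> h \<otimes> s i)"
      "\<exists>y\<in>carrier A. \<forall>i\<in>I. y \<otimes> (g \<otimes> compl h \<otimes> s i) = x i \<otimes> (g \<otimes> compl h \<otimes> s i)"
  then obtain y z where
    y: "y \<in> carrier A" "\<And>i. i \<in> I \<Longrightarrow> y \<otimes> (g \<otimes> h \<otimes> s i) = x i \<otimes> (g \<otimes> h \<otimes> s i)" and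
    z: "z \<in> carrier A" "\<And>i. i \<in> I \<Longrightarrow> z \<otimes> (g \<otimes> compl h \<otimes> s i) = x i \<otimes> (g \<otimes> compl h \<otimes> s i)"
    by blast
  have cl: "g \<in> carrier A" "h \<in> carrier A" "compl h \<in> carrier A"
    using gh idem_carrier compl_carrier by auto
  obtain w where w: "w \<in> (y \<otimes> h) \<boxplus> (z \<otimes> compl h)"
    using madd_nonempty[of "y \<otimes> h" "z \<otimes> compl h"] y z cl by auto
  have wc: "w \<in> carrier A" using w y z cl madd_carrier by blast
  note wh = piecewise_element[OF gh(2) y(1) z(1) w]
  have "w \<otimes> (g \<otimes> s i) = x i \<otimes> (g \<otimes> s i)" if i: "i \<in> I" for i
  proof (rule eq_if_piecewise_eq[OF t gh(2)])
    note ic = x[OF i] idem_carrier[OF s[OF i]]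
    have ac: "t \<otimes> (g \<otimes> s i) \<otimes> k = t \<otimes> (g \<otimes> k \<otimes> s i)" "t \<otimes> (g \<otimes> k \<otimes> s i) = t \<otimes> k \<otimes> (g \<otimes> s i)"
      if "t \<in> carrier A" "k \<in> carrier A" for t k
      using that ic cl by (simp_all add: m_ac)
    show "w \<otimes> (g \<otimes> s i) \<in> carrier A" "x i \<otimes> (g \<otimes> s i) \<in> carrier A"
      using wc ic cl by auto
    show "w \<otimes> (g \<otimes> s i) \<otimes> h = x i \<otimes> (g \<otimes> s i) \<otimes> h"
      using ac[OF wc cl(2)] ac[OF y(1) cl(2)] ac(1)[OF ic(1) cl(2)] wh(1) y(2)[OF i] by simp
    show "w \<otimes> (g \<otimes> s i) \<otimes> compl h = x i \<otimes> (g \<otimes> s i) \<otimes> compl h"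
      using ac[OF wc cl(3)] ac[OF z(1) cl(3)] ac(1)[OF ic(1) cl(3)] wh(2) z(2)[OF i] by simp
  qed
  then show "\<exists>y\<in>carrier A. \<forall>i\<in>I. y \<otimes> (g \<otimes> s i) = x i \<otimes> (g \<otimes> s i)"
    using wc by blast
next
  fix p assume "p \<in> spec A" "e \<notin> p"
  then obtain i where i: "i \<in> I" "s i \<notin> p" using cover by blast
  then show "\<exists>f. idem f \<and> f \<notin> p \<and>
      (\<exists>y\<in>carrier A. \<forall>j\<in>I. y \<otimes> (f \<otimes> s j) = x j \<otimes> (f \<otimes> s j))"
    using s x compat by blast
qed

end

section \<open>The equivalences\<close>

context von_neumann_hyperring
begin

lemma basic_cover_supp:
  assumes "basic_cover A e I f" "i \<in> I"
  shows "e \<in> carrier A" "f i \<in> carrier A" "supp (f i) \<otimes> supp e = supp (f i)"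
proof -
  show "e \<in> carrier A" "f i \<in> carrier A"
    using assms unfolding basic_cover_def by auto
  then show "supp (f i) \<otimes> supp e = supp (f i)"
    using assms unfolding basic_cover_def by (intro supp_mult_if_basic_open_subset) auto
qed

lemma basic_cover_supp_notin:
  assumes cov: "basic_cover A e I f" and p: "p \<in> spec A" "supp e \<notin> p"
  shows "\<exists>i\<in>I. supp (f i) \<notin> p"
proof -
  have "e \<in> carrier A" "\<And>i. i \<in> I \<Longrightarrow> f i \<in> carrier A"
    and open_eq: "basic_open A e = (\<Union>i\<in>I. basic_open A (f i))"
    using cov unfolding basic_cover_def by auto
  moreover have "p \<in> basic_open A e"
    using p supp_mem_prime_iff[OF p(1)] \<open>e \<in> carrier A\<close> unfolding basic_open_def by auto
  ultimately obtain i where "i \<in> I" "f i \<in> carrier A" "f i \<notin> p"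
    unfolding basic_open_def by blast
  then show ?thesis using supp_mem_prime_iff[OF p(1)] by blast
qed

lemma monopresheaf_if_idem_sums_trivial:
  assumes t: idem_sums_trivial
  shows "monopresheaf A"
  unfolding monopresheaf_def
proof (intro allI impI ballI)
  fix e and I :: "'a set" and f a b c
  assume cov: "basic_cover A e I f"
    and a: "a \<in> carrier (sections A e)" and b: "b \<in> carrier (sections A e)"
    and c: "c \<in> carrier (sections A e)"
    and loc: "\<forall>i\<in>I. restr A e (f i) a \<in>
      restr A e (f i) b \<boxplus>\<^bsub>sections A (f i)\<^esub> restr A e (f i) c"
  have e: "e \<in> carrier A" using cov unfolding basic_cover_def by blast
  obtain x where x: "x \<in> carrier A" "a = frac A (denoms A e) x \<one>" using section_carrierE[OF e a] .
  obtain y where y: "y \<in> carrier A" "b = frac A (denoms A e) y \<one>" using section_carrierE[OF e b] .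
  obtain z where z: "z \<in> carrier A" "c = frac A (denoms A e) z \<one>" using section_carrierE[OF e c] .
  have loc': "x \<otimes> supp (f i) \<in> (y \<otimes> supp (f i)) \<boxplus> (z \<otimes> supp (f i))" if i: "i \<in> I" for i
  proof -
    note fi = basic_cover_supp(2)[OF cov i]
    note res = restr_section[OF fi e basic_cover_supp(3)[OF cov i]]
    have "restr A e (f i) a \<in> restr A e (f i) b \<boxplus>\<^bsub>sections A (f i)\<^esub> restr A e (f i) c"
      using loc i by blast
    then show ?thesis
      unfolding x(2) y(2) z(2) res[OF x(1)] res[OF y(1)] res[OF z(1)]
        section_madd_iff[OF fi x(1) y(1) z(1)] .
  qed
  have "x \<otimes> supp e \<in> (y \<otimes> supp e) \<boxplus> (z \<otimes> supp e)"
  proof (rule madd_local[OF t x(1) y(1) z(1) supp_idem[OF e]])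
    fix p assume "p \<in> spec A" "supp e \<notin> p"
    then show "\<exists>g. idem g \<and> g \<notin> p \<and> x \<otimes> g \<in> (y \<otimes> g) \<boxplus> (z \<otimes> g)"
      using basic_cover_supp_notin[OF cov] loc' basic_cover_supp(2)[OF cov] supp_idem by blast
  qed
  then show "a \<in> b \<boxplus>\<^bsub>sections A e\<^esub> c"
    using section_madd_iff[OF e x(1) y(1) z(1)] x y z by simp
qed

lemma gluing_if_idem_sums_trivial:
  assumes t: idem_sums_trivial
  shows "gluing A"
  unfolding gluing_def
proof (intro allI impI)
  fix e and I :: "'a set" and f X
  assume cov: "basic_cover A e I f"
    and X: "\<forall>i\<in>I. X i \<in> carrier (sections A (f i))"
    and compat: "\<forall>i\<in>I. \<forall>j\<in>I.
      restr A (f i) (f i \<otimes> f j) (X i) = restr A (f j) (f i \<otimes> f j) (X j)"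
  have e: "e \<in> carrier A" using cov unfolding basic_cover_def by blast
  note fc = basic_cover_supp(2)[OF cov]
  have "\<forall>i\<in>I. \<exists>x. x \<in> carrier A \<and> X i = frac A (denoms A (f i)) x \<one>"
    using section_carrierE[OF fc] X by metis
  then obtain x where x: "\<And>i. i \<in> I \<Longrightarrow> x i \<in> carrier A"
    "\<And>i. i \<in> I \<Longrightarrow> X i = frac A (denoms A (f i)) (x i) \<one>"
    by metis
  have agree: "x i \<otimes> (supp (f i) \<otimes> supp (f j)) = x j \<otimes> (supp (f i) \<otimes> supp (f j))"
    if ij: "i \<in> I" "j \<in> I" for i j
  proof -
    note fij = m_closed[OF fc[OF ij(1)] fc[OF ij(2)]]
    have sub: "supp (f i \<otimes> f j) \<otimes> supp (f i) = supp (f i \<otimes> f j)"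
      "supp (f i \<otimes> f j) \<otimes> supp (f j) = supp (f i \<otimes> f j)"
      using fc ij supp_carrier supp_idem
      by (simp_all add: supp_mult m_ac idem_left idem_mult_self)
    have "restr A (f i) (f i \<otimes> f j) (X i) = restr A (f j) (f i \<otimes> f j) (X j)"
      using compat ij by blast
    then have "frac A (denoms A (f i \<otimes> f j)) (x i) \<one> = frac A (denoms A (f i \<otimes> f j)) (x j) \<one>"
      unfolding x(2)[OF ij(1)] x(2)[OF ij(2)]
        restr_section[OF fij fc[OF ij(1)] sub(1) x(1)[OF ij(1)]]
        restr_section[OF fij fc[OF ij(2)] sub(2) x(1)[OF ij(2)]] .
    then show ?thesis
      using section_eq_iff[of "f i \<otimes> f j" "x i" "x j"] ij x fc by (simp add: supp_mult)
  qed
  have "\<exists>y\<in>carrier A. \<forall>i\<in>I. y \<otimes> (supp e \<otimes> supp (f i)) = x i \<otimes> (supp e \<otimes> supp (f i))"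
    by (rule glue_local[OF t supp_idem[OF fc] x(1) agree supp_idem[OF e]
          basic_cover_supp_notin[OF cov]])
  then obtain y where y: "y \<in> carrier A"
    "\<And>i. i \<in> I \<Longrightarrow> y \<otimes> (supp e \<otimes> supp (f i)) = x i \<otimes> (supp e \<otimes> supp (f i))"
    by blast
  have "restr A e (f i) (frac A (denoms A e) y \<one>) = X i" if i: "i \<in> I" for i
  proof -
    have "supp e \<otimes> supp (f i) = supp (f i)"
      using basic_cover_supp(3)[OF cov i] e fc[OF i] supp_carrier by (simp add: m_comm)
    then have "y \<otimes> supp (f i) = x i \<otimes> supp (f i)" using y(2)[OF i] by simp
    then show ?thesis
      using restr_section[OF fc[OF i] e basic_cover_supp(3)[OF cov i] y(1)] x i
        section_eq_iff[OF fc[OF i] y(1) x(1)[OF i]] by simp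
  qed
  then show "\<exists>y\<in>carrier (sections A e). \<forall>i\<in>I. restr A e (f i) y = X i"
    using section_closed[OF e y(1)] by blast
qed

lemma madd_iff_residues:
  assumes t: idem_sums_trivial and abc: "a \<in> carrier A" "b \<in> carrier A" "c \<in> carrier A"
  shows "a \<in> b \<boxplus> c \<longleftrightarrow>
    (\<forall>p\<in>spec A. to_residue A p a \<in> to_residue A p b \<boxplus>\<^bsub>residue A p\<^esub> to_residue A p c)"
proof
  assume "a \<in> b \<boxplus> c"
  then show "\<forall>p\<in>spec A. to_residue A p a \<in> to_residue A p b \<boxplus>\<^bsub>residue A p\<^esub> to_residue A p c"
    using to_residue_madd_iff[OF _ abc] idem_one one_notin_prime abc by auto
next
  assume "\<forall>p\<in>spec A. to_residue A p a \<in> to_residue A p b \<boxplus>\<^bsub>residue A p\<^esub> to_residue A p c"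
  then have "a \<otimes> \<one> \<in> (b \<otimes> \<one>) \<boxplus> (c \<otimes> \<one>)"
    using madd_local[OF t abc idem_one] to_residue_madd_iff[OF _ abc] by blast
  then show "a \<in> b \<boxplus> c" using abc by simp
qed

text \<open>Equality is the sum relation \<open>a \<in> b + 0\<close>.\<close>

lemma eq_iff_residues:
  assumes t: idem_sums_trivial and ab: "a \<in> carrier A" "b \<in> carrier A"
  shows "a = b \<longleftrightarrow> (\<forall>p\<in>spec A. to_residue A p a = to_residue A p b)"
proof
  assume eq: "\<forall>p\<in>spec A. to_residue A p a = to_residue A p b"
  have "b \<in> b \<boxplus> \<zero>" using ab by (simp add: madd_zero)
  then have "a \<in> b \<boxplus> \<zero>"
    using madd_iff_residues[OF t ab(2) ab(2) mzero_closed] madd_iff_residues[OF t ab mzero_closed] eq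
    by simp
  then show "a = b" using ab by (simp add: madd_zero)
qed auto

text \<open>An element of \<open>e + e'\<close>, with \<open>e'\<close> the complement of \<open>e\<close>, agrees with \<open>1\<close> on \<open>e\<close> and on \<open>e'\<close>,
  and every prime misses one of the two.\<close>

lemma idem_sums_trivial_if_residues_detect_one:
  assumes detect: "\<forall>u\<in>carrier A.
      (\<forall>p\<in>spec A. to_residue A p u = \<one>\<^bsub>residue A p\<^esub>) \<longrightarrow> u = \<one>"
  shows idem_sums_trivial
proof (rule idem_sums_trivialI)
  fix e u assume e: "idem e" and u: "u \<in> e \<boxplus> compl e"
  have ec: "e \<in> carrier A" "compl e \<in> carrier A" using e idem_carrier compl_carrier by auto
  have uc: "u \<in> carrier A" using u ec madd_carrier by blast
  have "u \<otimes> e = \<one> \<otimes> e" "u \<otimes> compl e = \<one> \<otimes> compl e"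
    using piecewise_element[OF e one_closed one_closed, of u] u ec by auto
  then have "to_residue A p u = to_residue A p \<one>" if "p \<in> spec A" for p
    using to_residue_eq_if_locally_eq[OF that uc one_closed] compl_mem_prime_iff[OF that e] e
      idem_compl[OF e] by metis
  then show "u = \<one>" using detect uc one_residue by simp
qed

text \<open>With \<open>e'\<close> the complement of \<open>e\<close>, an element \<open>u\<close> of \<open>e + e'\<close> satisfies \<open>u \<in> 1 + 0\<close> over both
  members of the cover \<open>D(1) = D(e) \<union> D(e')\<close>, hence globally.\<close>

lemma idem_sums_trivial_if_monopresheaf:
  assumes mono: "monopresheaf A"
  shows idem_sums_trivial
proof (rule idem_sums_trivialI)
  fix e u assume e: "idem e" and u: "u \<in> e \<boxplus> compl e"
  have ec: "e \<in> carrier A" "compl e \<in> carrier A" using e idem_carrier compl_carrier by auto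
  have uc: "u \<in> carrier A" using u ec madd_carrier by blast
  define I where "I = {e, compl e}"
  have I: "i \<in> carrier A" "supp i = i" "u \<otimes> i = \<one> \<otimes> i" if "i \<in> I" for i
    using that piecewise_element[OF e one_closed one_closed, of u] u ec e
    by (auto simp: I_def supp_of_idem idem_compl)
  have cov: "basic_cover A \<one> I (\<lambda>i. i)"
    using compl_mem_prime_iff[OF _ e] one_notin_prime I(1)
    unfolding basic_cover_def basic_open_def I_def by auto
  define F where "F = frac A (denoms A \<one>)"
  have "restr A \<one> i (F u \<one>) \<in>
      restr A \<one> i (F \<one> \<one>) \<boxplus>\<^bsub>sections A i\<^esub> restr A \<one> i (F \<zero> \<one>)" if i: "i \<in> I" for i
  proof -
    have "restr A \<one> i (F x \<one>) = frac A (denoms A i) x \<one>" if "x \<in> carrier A" for x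
      unfolding F_def using restr_section[OF I(1)[OF i] one_closed _ that] I[OF i]
      by (simp add: supp_of_idem idem_one)
    moreover have "u \<otimes> i \<in> (\<one> \<otimes> i) \<boxplus> (\<zero> \<otimes> i)"
      using I[OF i] uc by (simp add: zero_mult madd_zero)
    ultimately show ?thesis
      using section_madd_iff[OF I(1)[OF i] uc one_closed mzero_closed] I(2)[OF i] uc mzero_closed
      by simp
  qed
  then have "F u \<one> \<in> F \<one> \<one> \<boxplus>\<^bsub>sections A \<one>\<^esub> F \<zero> \<one>"
    using mono cov section_closed[OF one_closed] uc mzero_closed
    unfolding monopresheaf_def F_def by blast
  then have "u \<in> \<one> \<boxplus> \<zero>"
    using section_madd_iff[OF one_closed uc one_closed mzero_closed] uc mzero_closed
    unfolding F_def by (simp add: supp_of_idem idem_one)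
  then show "u = \<one>" using madd_zero uc by simp
qed

end

theorem theorem3p5:
  fixes A :: "'a multiring"
  defines "cond_i \<equiv> monopresheaf A"
    and "cond_ii \<equiv> \<forall>u\<in>carrier A.
      (\<forall>p\<in>spec A. to_residue A p u = \<one>\<^bsub>residue A p\<^esub>) \<longrightarrow> u = \<one>\<^bsub>A\<^esub>"
    and "cond_iii \<equiv> \<forall>e. is_idempotent A e \<longrightarrow> e \<boxplus>\<^bsub>A\<^esub> idem_compl A e = {\<one>\<^bsub>A\<^esub>}"
  assumes "von_neumann_hyperring A"
  shows "(cond_i \<longleftrightarrow> cond_ii) \<and> (cond_ii \<longleftrightarrow> cond_iii) \<and>
    (cond_i \<or> cond_ii \<or> cond_iii \<longrightarrow>
      geometric A \<and>
      (\<forall>a\<in>carrier A. \<forall>b\<in>carrier A. \<forall>c\<in>carrier A.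
        a \<in> b \<boxplus>\<^bsub>A\<^esub> c \<longleftrightarrow>
        (\<forall>p\<in>spec A. to_residue A p a \<in> to_residue A p b \<boxplus>\<^bsub>residue A p\<^esub> to_residue A p c)) \<and>
      (\<forall>a\<in>carrier A. \<forall>b\<in>carrier A.
        a = b \<longleftrightarrow> (\<forall>p\<in>spec A. to_residue A p a = to_residue A p b)))"
proof -
  interpret von_neumann_hyperring A by fact
  have iii: "cond_iii \<longleftrightarrow> idem_sums_trivial"
    unfolding cond_iii_def idem_sums_trivial_def ..
  have i: "cond_i \<longleftrightarrow> idem_sums_trivial"
    unfolding cond_i_def
    using idem_sums_trivial_if_monopresheaf monopresheaf_if_idem_sums_trivial by blast
  have ii: "cond_ii \<longleftrightarrow> idem_sums_trivial"
  proof
    show idem_sums_trivial if cond_ii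
      using that unfolding cond_ii_def by (rule idem_sums_trivial_if_residues_detect_one)
    show cond_ii if idem_sums_trivial
      unfolding cond_ii_def using eq_iff_residues[OF that _ one_closed] one_residue by simp
  qed
  show ?thesis
    unfolding i ii iii geometric_def
    using monopresheaf_if_idem_sums_trivial gluing_if_idem_sums_trivial
      madd_iff_residues eq_iff_residues by simp
qed

end
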